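(* Let $\mathcal{V}_1$ and $\mathcal{V}_2$ be matrix subspaces of $\mathbb{C}^{n\times n}$ over $\mathbb{C}$ (or over $\mathbb{R}$), and let the rank of $\Psi$ attain its maximum at $(V_1,V_2)\in\mathcal{V}_1\times\mathcal{V}_2$. Let $(W_1,W_2)\in\mathcal{V}_1\times\mathcal{V}_2$. Then, for the image of a (sufficiently small) neighbourhood of $(V_1,V_2)$ under $\Psi$, regarded as a Riemannian submanifold of $\mathbb{C}^{n\times n}$, the extrinsic curvature at $\Psi(V_1,V_2)$ of the geodesic passing through $\Psi(V_1,V_2)$ with the speed vector $V_1W_2+W_1V_2$ equals $$\left\| Q_{(V_1,V_2)}(W_1,W_2)\right\|_F,\qquad Q_{(V_1,V_2)}(W_1,W_2)=2(I-\mathbf{P}_{V_1,V_2})(W_1W_2).$$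
   Context: A matrix subspace of $\mathbb{C}^{n\times n}$ over $\mathbb{C}$ (or $\mathbb{R}$) is a linear subspace over that field. $\Psi:\mathcal{V}_1\times\mathcal{V}_2\to\mathbb{C}^{n\times n}$ is the bilinear map $\Psi(V_1,V_2)=V_1V_2$; its rank at $(V_1,V_2)$ is the dimension (over the field in question) of the subspace $V_1\mathcal{V}_2+\mathcal{V}_1V_2=\{V_1W_2+W_1V_2 : W_1\in\mathcal{V}_1,\ W_2\in\mathcal{V}_2\}$. $\mathbb{C}^{n\times n}$ carries the inner product $(A,B)=\mathrm{tr}(B^*A)$ (its real part when working over $\mathbb{R}$), with associated Frobenius norm $\|\cdot\|_F$; the Riemannian metric on submanifolds is the one induced by the real part of this inner product. $\mathbf{P}_{V_1,V_2}$ is the orthogonal projector on $\mathbb{C}^{n\times n}$ onto $V_1\mathcal{V}_2+\mathcal{V}_1V_2$. If the rank of $\Psi$ is maximal at $(V_1,V_2)$, the image under $\Psi$ of a small neighbourhood of $(V_1,V_2)$ is a smooth submanifold of $\mathbb{C}^{n\times n}$ whose tangent space at $\Psi(V_1,V_2)=V_1V_2$ is $V_1\mathcal{V}_2+\mathcal{V}_1V_2$. The extrinsic curvature at $\gamma(0)$ of a geodesic $\gamma$ of this submanifold is the norm $\|\gamma''(0)\|_F$ of its acceleration in the ambient space $\mathbb{C}^{n\times n}$. *)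

theory Defs
  imports "HOL-Analysis.Analysis"
begin

section \<open>Complex matrices as a real and as a complex inner product space\<close>

text \<open>The library makes \<^typ>\<open>complex^'n^'n\<close> a real Euclidean space only. The complex vector space
  structure is added here.\<close>

definition cscale :: "complex \<Rightarrow> complex^'n^'n \<Rightarrow> complex^'n^'n" where
  "cscale c A = (\<chi> i j. c * A $ i $ j)"

global_interpretation cmat: vector_space "cscale :: complex \<Rightarrow> complex^'n^'n \<Rightarrow> complex^'n^'n"
  defines cmat_subspace = cmat.subspace
    and cmat_dependent = cmat.dependent
    and cmat_span = cmat.span
    and cmat_dim = cmat.dim
    and cmat_representation = cmat.representation
    and cmat_extend_basis = cmat.extend_basis
  by unfold_locales (simp_all add: cscale_def vec_eq_iff algebra_simps)

definition conj_transpose :: "complex^'n^'n \<Rightarrow> complex^'n^'n" where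
  "conj_transpose A = (\<chi> i j. cnj (A $ j $ i))"

definition trace_inner :: "complex^'n^'n \<Rightarrow> complex^'n^'n \<Rightarrow> complex" where
  "trace_inner A B = trace (conj_transpose B ** A)"

text \<open>The library's inner product and norm on \<^typ>\<open>complex^'n^'n\<close> are the real part of the trace inner
  product and the Frobenius norm.\<close>

lemma Re_trace_inner: "Re (trace_inner A B) = A \<bullet> B"
proof -
  have "Re (trace_inner A B) = (\<Sum>i\<in>UNIV. \<Sum>k\<in>UNIV. A $ k $ i \<bullet> B $ k $ i)"
    by (simp add: trace_inner_def trace_def conj_transpose_def matrix_matrix_mult_def
        inner_complex_def algebra_simps)
  also have "\<dots> = A \<bullet> B"
    by (subst sum.swap) (simp add: inner_vec_def)
  finally show ?thesis .
qed

lemma norm_eq_Frobenius: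
  fixes A :: "complex^'n^'n"
  shows "norm A = sqrt (\<Sum>i\<in>UNIV. \<Sum>j\<in>UNIV. (cmod (A $ i $ j))\<^sup>2)"
  by (simp add: norm_vec_def L2_set_def sum_nonneg)

lemma norm_eq_sqrt_trace_inner: "norm A = sqrt (Re (trace_inner A A))"
  by (simp add: Re_trace_inner norm_eq_sqrt_inner)

datatype ground_field = Real_Field | Complex_Field

fun matrix_subspace :: "ground_field \<Rightarrow> (complex^'n^'n) set \<Rightarrow> bool" where
  "matrix_subspace Real_Field S = subspace S"
| "matrix_subspace Complex_Field S = cmat_subspace S"

fun matrix_dim :: "ground_field \<Rightarrow> (complex^'n^'n) set \<Rightarrow> nat" where
  "matrix_dim Real_Field S = dim S"
| "matrix_dim Complex_Field S = cmat_dim S"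

fun field_inner :: "ground_field \<Rightarrow> complex^'n^'n \<Rightarrow> complex^'n^'n \<Rightarrow> complex" where
  "field_inner Real_Field A B = complex_of_real (Re (trace_inner A B))"
| "field_inner Complex_Field A B = trace_inner A B"

text \<open>The orthogonal projection of \<open>x\<close> onto \<open>S\<close> with respect to the inner product \<open>ip\<close>. It is
  well defined whenever \<open>S\<close> is a (finite-dimensional) subspace over the field of \<open>ip\<close>.\<close>

definition orth_proj :: "('a::ab_group_add \<Rightarrow> 'a \<Rightarrow> 'b::zero) \<Rightarrow> 'a set \<Rightarrow> 'a \<Rightarrow> 'a" where
  "orth_proj ip S x = (THE p. p \<in> S \<and> (\<forall>y\<in>S. ip (x - p) y = 0))"


section \<open>Smooth maps and submanifolds of Euclidean space\<close>

text \<open>\<open>Ck_on k f S\<close> is meant for open \<open>S\<close>: there the successor clause says that \<open>f\<close> is differentiable and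
  all its directional derivatives are of class \<open>k\<close>.\<close>

fun Ck_on :: "nat \<Rightarrow> ('a::euclidean_space \<Rightarrow> 'b::euclidean_space) \<Rightarrow> 'a set \<Rightarrow> bool" where
  "Ck_on 0 f S \<longleftrightarrow> continuous_on S f"
| "Ck_on (Suc k) f S \<longleftrightarrow>
    (\<exists>f'. (\<forall>x\<in>S. (f has_derivative f' x) (at x)) \<and> (\<forall>v. Ck_on k (\<lambda>x. f' x v) S))"

definition smooth_on :: "'a set \<Rightarrow> ('a::euclidean_space \<Rightarrow> 'b::euclidean_space) \<Rightarrow> bool" where
  "smooth_on S f \<longleftrightarrow> (\<forall>k. Ck_on k f S)"

text \<open>Embedded submanifolds, by slice charts of the ambient space.\<close>

definition smooth_submanifold :: "'a::euclidean_space set \<Rightarrow> bool" where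
  "smooth_submanifold M \<longleftrightarrow>
    (\<exists>d. \<forall>p\<in>M. \<exists>A (B :: 'a set) \<phi> \<psi> L.
       open A \<and> p \<in> A \<and> open B \<and> homeomorphism A B \<phi> \<psi> \<and> smooth_on A \<phi> \<and> smooth_on B \<psi> \<and>
       subspace L \<and> dim L = d \<and> \<phi> ` (M \<inter> A) = B \<inter> L)"

definition tangent_space :: "'a::euclidean_space set \<Rightarrow> 'a \<Rightarrow> 'a set" where
  "tangent_space M p =
    {v. \<exists>e>0. \<exists>c. smooth_on {-e<..<e} c \<and> c ` {-e<..<e} \<subseteq> M \<and> c 0 = p \<and>
          (c has_vector_derivative v) (at (0::real))}"

text \<open>The Levi-Civita covariant derivative, along the curve \<open>c\<close>, of a field \<open>X\<close> of tangent vectors, for the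
  metric that \<open>M\<close> inherits from the ambient Euclidean space: the tangential part of the ambient
  derivative.\<close>

definition covariant_derivative ::
    "'a::euclidean_space set \<Rightarrow> (real \<Rightarrow> 'a) \<Rightarrow> (real \<Rightarrow> 'a) \<Rightarrow> real \<Rightarrow> 'a" where
  "covariant_derivative M c X t =
    orth_proj (\<bullet>) (tangent_space M (c t)) (vector_derivative X (at t))"

definition velocity :: "(real \<Rightarrow> 'a::euclidean_space) \<Rightarrow> real \<Rightarrow> 'a" where
  "velocity c t = vector_derivative c (at t)"

definition acceleration :: "(real \<Rightarrow> 'a::euclidean_space) \<Rightarrow> real \<Rightarrow> 'a" where
  "acceleration c t = vector_derivative (velocity c) (at t)"

definition geodesic_on :: "'a::euclidean_space set \<Rightarrow> real set \<Rightarrow> (real \<Rightarrow> 'a) \<Rightarrow> bool" where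
  "geodesic_on M I c \<longleftrightarrow>
    open I \<and> is_interval I \<and> smooth_on I c \<and> c ` I \<subseteq> M \<and>
    (\<forall>t\<in>I. covariant_derivative M c (velocity c) t = 0)"

definition geodesic_from :: "'a::euclidean_space set \<Rightarrow> 'a \<Rightarrow> 'a \<Rightarrow> real set \<Rightarrow> (real \<Rightarrow> 'a) \<Rightarrow> bool" where
  "geodesic_from M p v I c \<longleftrightarrow> geodesic_on M I c \<and> 0 \<in> I \<and> c 0 = p \<and> velocity c 0 = v"

definition extrinsic_curvature :: "(real \<Rightarrow> 'a::euclidean_space) \<Rightarrow> real \<Rightarrow> real" where
  "extrinsic_curvature c t = norm (acceleration c t)"


section \<open>The product map of two matrix subspaces\<close>

type_synonym 'n cmat = "complex^'n^'n"

definition \<Psi> :: "'n::finite cmat \<times> 'n cmat \<Rightarrow> 'n cmat" where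
  "\<Psi> = (\<lambda>(X, Y). X ** Y)"

definition derivative_image ::
    "'n::finite cmat set \<Rightarrow> 'n cmat set \<Rightarrow> 'n cmat \<Rightarrow> 'n cmat \<Rightarrow> 'n cmat set" where
  "derivative_image \<V>1 \<V>2 V1 V2 = {V1 ** W2 + W1 ** V2 | W1 W2. W1 \<in> \<V>1 \<and> W2 \<in> \<V>2}"

definition \<Psi>_rank ::
    "ground_field \<Rightarrow> 'n::finite cmat set \<Rightarrow> 'n cmat set \<Rightarrow> 'n cmat \<Rightarrow> 'n cmat \<Rightarrow> nat" where
  "\<Psi>_rank F \<V>1 \<V>2 V1 V2 = matrix_dim F (derivative_image \<V>1 \<V>2 V1 V2)"

definition proj_P ::
    "ground_field \<Rightarrow> 'n::finite cmat set \<Rightarrow> 'n cmat set \<Rightarrow> 'n cmat \<Rightarrow> 'n cmat \<Rightarrow> 'n cmat \<Rightarrow> 'n cmat" where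
  "proj_P F \<V>1 \<V>2 V1 V2 = orth_proj (field_inner F) (derivative_image \<V>1 \<V>2 V1 V2)"

definition quadratic_Q ::
    "ground_field \<Rightarrow> 'n::finite cmat set \<Rightarrow> 'n cmat set \<Rightarrow> 'n cmat \<Rightarrow> 'n cmat \<Rightarrow>
     'n cmat \<Rightarrow> 'n cmat \<Rightarrow> 'n cmat" where
  "quadratic_Q F \<V>1 \<V>2 V1 V2 W1 W2 =
    2 *\<^sub>R (W1 ** W2 - proj_P F \<V>1 \<V>2 V1 V2 (W1 ** W2))"

definition open_nhd_in :: "'a::topological_space set \<Rightarrow> 'a \<Rightarrow> 'a set \<Rightarrow> bool" where
  "open_nhd_in S x U \<longleftrightarrow> openin (top_of_set S) U \<and> x \<in> U"

end

theory Submission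
  imports Defs
begin

text \<open>Let \<open>z = (V1, V2)\<close>, let \<open>T = V1 \<V>2 + \<V>1 V2\<close> be the image of
  \<open>\<V>1 \<times> \<V>2\<close> under the derivative of \<open>\<Psi>\<close> at \<open>z\<close>
  and let \<open>v = V1 W2 + W1 V2\<close>. Suppose that \<open>\<Psi> ` U\<close> is a submanifold \<open>M\<close> with tangent space \<open>T\<close> at \<open>\<Psi> z\<close>.
  The curve \<open>d t = (V1 + t W1) (V2 + t W2)\<close> lies in \<open>M\<close> for small \<open>t\<close>, has velocity \<open>v\<close> and has
  acceleration \<open>2 W1 W2\<close> at \<open>t = 0\<close>. Differentiating a defining equation \<open>\<rho> = 0\<close> of \<open>M\<close> twice along a curve
  shows that the normal part of the acceleration depends only on the velocity, so a geodesic \<open>c\<close> with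
  velocity \<open>v\<close> and the curve \<open>d\<close> have accelerations that differ by an element of \<open>T\<close>. The acceleration of the geodesic is
  orthogonal to \<open>T\<close>, so it is \<open>2 (W1 W2 - P (W1 W2))\<close> with \<open>P\<close> the orthogonal projection onto \<open>T\<close>; see
  \<open>geodesic_acceleration\<close> and \<open>product_along_line\<close>.

  That \<open>\<Psi> ` U\<close> is a submanifold is the constant rank theorem (\<open>constant_rank_image\<close>): since no rank exceeds
  the rank at \<open>z\<close>, every image of a small neighbourhood is the image of an open piece of the
  linear space \<open>T\<close> under a diffeomorphism \<open>h\<close> between open sets of the ambient space. Such images
  are the subject of the locale \<open>straightened_submanifold\<close>: tangent spaces are read off
  from \<open>h\<close>, and geodesics exist because in the coordinates of \<open>T\<close> they solve a second-order differential
  equation with smooth right-hand side (\<open>geodesic_exists\<close>). Behind these two facts are a smooth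
  inverse function theorem and the smooth Picard-Lindelof theorem (\<open>smooth_inverse_function\<close>, \<open>smooth_ode_solution\<close>).
  Both gain their smoothness by bootstrapping: a map whose derivative is a smooth expression in
  the map itself is as smooth as that expression.

  Over the complex numbers the same real argument applies: a complex subspace has twice its complex
  dimension as real dimension, so the real rank is maximal at \<open>z\<close> as well, and the orthogonal complements for the
  Hermitian inner product and for its real part coincide (\<open>dim_eq_twice_cmat_dim\<close>, \<open>orth_proj_field_inner\<close>).\<close>

section \<open>Calculus of smooth maps\<close>

abbreviation Df :: "('a::euclidean_space \<Rightarrow> 'b::euclidean_space) \<Rightarrow> 'a \<Rightarrow> 'a \<Rightarrow> 'b" where
  "Df f x \<equiv> frechet_derivative f (at x)"

lemma Df_eq: "(f has_derivative f') (at x) \<Longrightarrow> Df f x = f'"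
  by (metis frechet_derivative_at)

lemma Ck_on_cong:
  assumes "open S" "\<And>x. x \<in> S \<Longrightarrow> f x = g x" "Ck_on k f S"
  shows "Ck_on k g S"
  using assms
proof (cases k)
  case 0
  then show ?thesis using assms by (metis Ck_on.simps(1) continuous_on_cong)
next
  case (Suc j)
  then obtain f' where f': "\<forall>x\<in>S. (f has_derivative f' x) (at x)" "\<forall>v. Ck_on j (\<lambda>x. f' x v) S"
    using assms by auto
  have "(g has_derivative f' x) (at x)" if "x \<in> S" for x
    using has_derivative_transform_within_open[of f "f' x" x UNIV S g] f' assms that by auto
  then show ?thesis using f' Suc by auto
qed

text \<open>On an open set the derivative is unique, so the existential quantifier in the definition of
  \<open>Ck_on\<close> has essentially one witness, and the class of \<open>f\<close> can be stated with \<open>Df\<close>.\<close>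

lemma Ck_on_Suc_iff:
  assumes "open S"
  shows "Ck_on (Suc k) f S \<longleftrightarrow>
    (\<forall>x\<in>S. (f has_derivative Df f x) (at x)) \<and> (\<forall>v. Ck_on k (\<lambda>x. Df f x v) S)" (is "?l \<longleftrightarrow> ?r")
proof
  assume ?l
  then obtain f' where f': "\<forall>x\<in>S. (f has_derivative f' x) (at x)" "\<forall>v. Ck_on k (\<lambda>x. f' x v) S"
    by auto
  have e: "Df f x = f' x" if "x \<in> S" for x using f' that by (auto intro: Df_eq)
  show ?r
  proof (intro conjI ballI allI)
    show "(f has_derivative Df f x) (at x)" if "x \<in> S" for x using e f' that by auto
    show "Ck_on k (\<lambda>x. Df f x v) S" for v
      by (rule Ck_on_cong[OF assms, of "\<lambda>x. f' x v"]) (use e f' in auto)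
  qed
qed auto

lemma Ck_on_SucI:
  assumes "open S" "\<And>x. x \<in> S \<Longrightarrow> (f has_derivative f' x) (at x)" "\<And>v. Ck_on k (\<lambda>x. f' x v) S"
  shows "Ck_on (Suc k) f S"
  using assms by auto

lemma Ck_on_SucD:
  assumes "open S" "Ck_on (Suc k) f S"
  shows "Ck_on k f S"
  using assms(2)
proof (induction k arbitrary: f)
  case 0
  then show ?case using assms(1)
    by (auto intro!: continuous_at_imp_continuous_on dest: has_derivative_continuous)
next
  case (Suc k)
  then show ?case unfolding Ck_on_Suc_iff[OF assms(1)] by blast
qed

lemma Ck_on_imp_continuous:
  assumes "open S" "Ck_on k f S" shows "continuous_on S f"
  using assms(2) by (induction k) (auto dest!: Ck_on_SucD[OF assms(1)] simp del: Ck_on.simps(2))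

lemma Ck_on_subset: "Ck_on k f S \<Longrightarrow> T \<subseteq> S \<Longrightarrow> Ck_on k f T"
proof (induction k arbitrary: f)
  case 0 then show ?case by (auto intro: continuous_on_subset)
next
  case (Suc k)
  then obtain f' where f': "\<forall>x\<in>S. (f has_derivative f' x) (at x)" "\<forall>v. Ck_on k (\<lambda>x. f' x v) S"
    by auto
  then show ?case using Suc by (auto intro!: exI[of _ f'])
qed

lemma Ck_on_const: "open S \<Longrightarrow> Ck_on k (\<lambda>x. c) S"
proof (induction k arbitrary: c)
  case (Suc k)
  show ?case by (rule Ck_on_SucI[where f'="\<lambda>x v. 0"]) (use Suc in auto)
qed auto

lemma Ck_on_linear:
  assumes "open S" "linear l" shows "Ck_on k l S"
proof (cases k)
  case 0 then show ?thesis using assms by (simp add: linear_continuous_on linear_conv_bounded_linear)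
next
  case (Suc j)
  show ?thesis unfolding Suc
    by (rule Ck_on_SucI[where f'="\<lambda>x. l"])
      (use assms Ck_on_const in \<open>auto intro: bounded_linear_imp_has_derivative simp: linear_conv_bounded_linear\<close>)
qed

lemma Ck_on_add:
  assumes "open S"
  shows "Ck_on k f S \<Longrightarrow> Ck_on k g S \<Longrightarrow> Ck_on k (\<lambda>x. f x + g x) S"
proof (induction k arbitrary: f g)
  case 0 then show ?case by (auto intro: continuous_on_add)
next
  case (Suc k)
  show ?case
    by (rule Ck_on_SucI[OF assms, where f'="\<lambda>x v. Df f x v + Df g x v"])
      (use Suc in \<open>auto simp: Ck_on_Suc_iff[OF assms] simp del: Ck_on.simps intro: has_derivative_add\<close>)
qed

lemma Ck_on_sum:
  assumes "open S" "\<And>i. i \<in> I \<Longrightarrow> Ck_on k (f i) S"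
  shows "Ck_on k (\<lambda>x. \<Sum>i\<in>I. f i x) S"
  using assms(2) by (induction I rule: infinite_finite_induct)
    (auto intro: Ck_on_const Ck_on_add assms simp del: Ck_on.simps)

lemma Ck_on_bilinear:
  fixes prod :: "'b::euclidean_space \<Rightarrow> 'c::euclidean_space \<Rightarrow> 'd::euclidean_space"
  assumes "open S" and bil: "bounded_bilinear prod"
  shows "Ck_on k f S \<Longrightarrow> Ck_on k g S \<Longrightarrow> Ck_on k (\<lambda>x. prod (f x) (g x)) S"
proof (induction k arbitrary: f g)
  case 0 then show ?case using bounded_bilinear.continuous_on[OF bil] by simp
next
  case (Suc k)
  have "Ck_on k f S" "Ck_on k g S" using Suc.prems Ck_on_SucD assms by blast+
  moreover have "(f has_derivative Df f x) (at x)" "(g has_derivative Df g x) (at x)" if "x \<in> S" for x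
    using Suc.prems that unfolding Ck_on_Suc_iff[OF assms(1)] by auto
  moreover have "Ck_on k (\<lambda>x. Df f x v) S" "Ck_on k (\<lambda>x. Df g x v) S" for v
    using Suc.prems unfolding Ck_on_Suc_iff[OF assms(1)] by auto
  ultimately show ?case
    by (intro Ck_on_SucI[OF assms(1), where f'="\<lambda>x v. prod (f x) (Df g x v) + prod (Df f x v) (g x)"]
       bounded_bilinear.FDERIV[OF bil] Ck_on_add[OF assms(1)] Suc.IH) auto
qed

text \<open>Smoothness of \<open>x \<mapsto> Df f x v\<close> is known for fixed \<open>v\<close> only. Expanding a variable
  direction in the standard basis reduces to that case.\<close>

lemma linear_basis_expansion:
  fixes l :: "'a::euclidean_space \<Rightarrow> 'b::real_vector"
  assumes "linear l"
  shows "l v = (\<Sum>b\<in>Basis. (v \<bullet> b) *\<^sub>R l b)"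
proof -
  have "l v = l (\<Sum>b\<in>Basis. (v \<bullet> b) *\<^sub>R b)" by (simp add: euclidean_representation)
  then show ?thesis using assms by (simp add: linear_sum linear_scale)
qed

lemma Ck_on_inner_left: "open S \<Longrightarrow> Ck_on k f S \<Longrightarrow> Ck_on k (\<lambda>x. f x \<bullet> b) S"
  by (rule Ck_on_bilinear[OF _ bounded_bilinear_inner]) (auto intro: Ck_on_const simp del: Ck_on.simps)

lemma Ck_on_scaleR: "open S \<Longrightarrow> Ck_on k f S \<Longrightarrow> Ck_on k g S \<Longrightarrow> Ck_on k (\<lambda>x. f x *\<^sub>R g x) S"
  by (rule Ck_on_bilinear[OF _ bounded_bilinear_scaleR])

lemma Ck_on_compose:
  assumes "open S" "open T" "f ` S \<subseteq> T"
  shows "Ck_on k f S \<Longrightarrow> Ck_on k g T \<Longrightarrow> Ck_on k (\<lambda>x. g (f x)) S"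
proof (induction k arbitrary: g)
  case 0 then show ?case using assms by (auto intro: continuous_on_compose2)
next
  case (Suc k)
  have f: "Ck_on k f S" "\<And>x. x \<in> S \<Longrightarrow> (f has_derivative Df f x) (at x)" "\<And>v. Ck_on k (\<lambda>x. Df f x v) S"
    using Ck_on_SucD[OF assms(1) Suc.prems(1)] Suc.prems(1)[unfolded Ck_on_Suc_iff[OF assms(1)]] by auto
  have g: "\<And>x. x \<in> T \<Longrightarrow> (g has_derivative Df g x) (at x)" "\<And>v. Ck_on k (\<lambda>x. Df g x v) T"
    using Suc.prems(2)[unfolded Ck_on_Suc_iff[OF assms(2)]] by auto
  show ?case
  proof (rule Ck_on_SucI[OF assms(1), where f'="\<lambda>x v. Df g (f x) (Df f x v)"])
    fix x assume x: "x \<in> S"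
    then have "f x \<in> T" using assms by auto
    then show "((\<lambda>x. g (f x)) has_derivative (\<lambda>v. Df g (f x) (Df f x v))) (at x)"
      using has_derivative_compose[OF f(2)[OF x]] g(1) by blast
  next
    fix v
    have "Ck_on k (\<lambda>x. \<Sum>b\<in>Basis. (Df f x v \<bullet> b) *\<^sub>R Df g (f x) b) S"
      by (intro Ck_on_sum Ck_on_scaleR Ck_on_inner_left f assms Suc.IH g)
    then show "Ck_on k (\<lambda>x. Df g (f x) (Df f x v)) S"
    proof (rule Ck_on_cong[OF assms(1), rotated])
      fix x assume "x \<in> S"
      then have "f x \<in> T" using assms by auto
      then have "linear (Df g (f x))" using g(1) has_derivative_linear by blast
      then show "(\<Sum>b\<in>Basis. (Df f x v \<bullet> b) *\<^sub>R Df g (f x) b) = Df g (f x) (Df f x v)"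
        by (metis linear_basis_expansion)
    qed
  qed
qed

lemma smooth_on_has_derivative: "smooth_on S f \<Longrightarrow> open S \<Longrightarrow> x \<in> S \<Longrightarrow> (f has_derivative Df f x) (at x)"
  unfolding smooth_on_def using Ck_on_Suc_iff by blast

lemma smooth_on_Df: "smooth_on S f \<Longrightarrow> open S \<Longrightarrow> smooth_on S (\<lambda>x. Df f x v)"
  unfolding smooth_on_def using Ck_on_Suc_iff by blast

lemma smooth_on_linear_Df: "smooth_on S f \<Longrightarrow> open S \<Longrightarrow> x \<in> S \<Longrightarrow> linear (Df f x)"
  using smooth_on_has_derivative has_derivative_linear by blast

lemma smooth_on_imp_continuous: "smooth_on S f \<Longrightarrow> open S \<Longrightarrow> continuous_on S f"
  unfolding smooth_on_def using Ck_on_imp_continuous by blast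

lemma smooth_on_cong: "smooth_on S f \<Longrightarrow> open S \<Longrightarrow> (\<And>x. x \<in> S \<Longrightarrow> f x = g x) \<Longrightarrow> smooth_on S g"
  unfolding smooth_on_def using Ck_on_cong by blast

lemma smooth_on_subset: "smooth_on S f \<Longrightarrow> T \<subseteq> S \<Longrightarrow> smooth_on T f"
  unfolding smooth_on_def using Ck_on_subset by blast

lemma smooth_on_const: "open S \<Longrightarrow> smooth_on S (\<lambda>x. c)"
  unfolding smooth_on_def using Ck_on_const by blast

lemma smooth_on_linear: "open S \<Longrightarrow> linear l \<Longrightarrow> smooth_on S l"
  unfolding smooth_on_def using Ck_on_linear by blast

lemma smooth_on_add: "open S \<Longrightarrow> smooth_on S f \<Longrightarrow> smooth_on S g \<Longrightarrow> smooth_on S (\<lambda>x. f x + g x)"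
  unfolding smooth_on_def using Ck_on_add by blast

lemma smooth_on_sum: "open S \<Longrightarrow> (\<And>i. i \<in> I \<Longrightarrow> smooth_on S (f i)) \<Longrightarrow> smooth_on S (\<lambda>x. \<Sum>i\<in>I. f i x)"
  unfolding smooth_on_def by (blast intro: Ck_on_sum)

lemma smooth_on_bilinear:
  fixes prod :: "'b::euclidean_space \<Rightarrow> 'c::euclidean_space \<Rightarrow> 'd::euclidean_space"
  shows "open S \<Longrightarrow> bounded_bilinear prod \<Longrightarrow> smooth_on S f \<Longrightarrow> smooth_on S g \<Longrightarrow> smooth_on S (\<lambda>x. prod (f x) (g x))"
  unfolding smooth_on_def using Ck_on_bilinear by blast

lemma smooth_on_inner: "open S \<Longrightarrow> smooth_on S f \<Longrightarrow> smooth_on S g \<Longrightarrow> smooth_on S (\<lambda>x. f x \<bullet> g x)"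
  using smooth_on_bilinear[OF _ bounded_bilinear_inner] .

lemma smooth_on_scaleR: "open S \<Longrightarrow> smooth_on S f \<Longrightarrow> smooth_on S g \<Longrightarrow> smooth_on S (\<lambda>x. f x *\<^sub>R g x)"
  using smooth_on_bilinear[OF _ bounded_bilinear_scaleR] .

lemma smooth_on_compose:
  "open S \<Longrightarrow> open T \<Longrightarrow> f ` S \<subseteq> T \<Longrightarrow> smooth_on S f \<Longrightarrow> smooth_on T g \<Longrightarrow> smooth_on S (\<lambda>x. g (f x))"
  unfolding smooth_on_def using Ck_on_compose by blast

lemma smooth_on_linear_compose: "open S \<Longrightarrow> linear l \<Longrightarrow> smooth_on S f \<Longrightarrow> smooth_on S (\<lambda>x. l (f x))"
  by (rule smooth_on_compose[of S UNIV]) (auto intro: smooth_on_linear)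

lemma smooth_on_uminus: "open S \<Longrightarrow> smooth_on S f \<Longrightarrow> smooth_on S (\<lambda>x. - f x)"
  by (rule smooth_on_linear_compose) (auto intro!: linearI)

lemma smooth_on_diff: "open S \<Longrightarrow> smooth_on S f \<Longrightarrow> smooth_on S g \<Longrightarrow> smooth_on S (\<lambda>x. f x - g x)"
  using smooth_on_add[of S f "\<lambda>x. - g x"] smooth_on_uminus by auto

section \<open>Smooth linear systems and the smooth inverse function theorem\<close>

text \<open>A product rule in which the first factor need only be continuous, because the second one
  vanishes at the point: the increment of \<open>a\<close> is then multiplied by a quantity of first order.\<close>

lemma has_derivative_scaleR_vanishing:
  fixes a :: "'a::real_normed_vector \<Rightarrow> real" and h :: "'a \<Rightarrow> 'b::real_normed_vector"
  assumes a: "isCont a x0" and h: "(h has_derivative h') (at x0)" and "h x0 = 0"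
  shows "((\<lambda>x. a x *\<^sub>R h x) has_derivative (\<lambda>v. a x0 *\<^sub>R h' v)) (at x0)"
proof -
  interpret h': bounded_linear h' using h by (rule has_derivative_bounded_linear)
  obtain K where K: "\<And>x. norm (h' x) \<le> norm x * K" "K \<ge> 0" using h'.nonneg_bounded by metis
  let ?q = "\<lambda>x. (h x - h x0 - h' (x - x0)) /\<^sub>R norm (x - x0)"
  have q: "?q \<midarrow>x0\<rightarrow> 0" using h unfolding has_derivative_at_within by simp
  have a0: "(\<lambda>x. a x - a x0) \<midarrow>x0\<rightarrow> 0" using a by (intro LIM_zero) (simp add: isCont_def)
  have bd: "(\<lambda>x. (a x - a x0) *\<^sub>R (h' (x - x0) /\<^sub>R norm (x - x0))) \<midarrow>x0\<rightarrow> 0"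
  proof (rule Lim_null_comparison[where g="\<lambda>x. \<bar>a x - a x0\<bar> * K"])
    have "norm (h' y /\<^sub>R norm y) \<le> K" for y
      using K(1)[of y] K(2) by (cases "y = 0") (auto simp: field_simps)
    then show "\<forall>\<^sub>F x in at x0. norm ((a x - a x0) *\<^sub>R (h' (x - x0) /\<^sub>R norm (x - x0))) \<le> \<bar>a x - a x0\<bar> * K"
      by (intro always_eventually allI) (simp only: norm_scaleR real_norm_def, rule mult_left_mono, auto)
    show "(\<lambda>x. \<bar>a x - a x0\<bar> * K) \<midarrow>x0\<rightarrow> 0"
      using tendsto_mult_left_zero[OF tendsto_rabs_zero[OF a0]] by blast
  qed
  have "(\<lambda>x. a x *\<^sub>R ?q x + (a x - a x0) *\<^sub>R (h' (x - x0) /\<^sub>R norm (x - x0))) \<midarrow>x0\<rightarrow> a x0 *\<^sub>R 0 + 0"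
    using a by (intro tendsto_intros q bd) (simp add: isCont_def)
  moreover have "a x *\<^sub>R ?q x + (a x - a x0) *\<^sub>R (h' (x - x0) /\<^sub>R norm (x - x0)) =
     (a x *\<^sub>R h x - a x0 *\<^sub>R h x0 - a x0 *\<^sub>R h' (x - x0)) /\<^sub>R norm (x - x0)" for x
    using \<open>h x0 = 0\<close> by (simp add: algebra_simps)
  ultimately show ?thesis unfolding has_derivative_at_within
    by (auto intro: bounded_linear_const_scaleR h'.bounded_linear_axioms)
qed

text \<open>An injective linear map stays bounded below under small perturbations, and
  \<open>S x (y x - y x0) = b x - S x (y x0)\<close> tends to zero.\<close>

lemma continuous_on_linear_solve:
  fixes y :: "'a::euclidean_space \<Rightarrow> 'b::euclidean_space" and S :: "'a \<Rightarrow> 'b \<Rightarrow> 'c::euclidean_space"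
  assumes "\<And>x. x \<in> U \<Longrightarrow> linear (S x)" "\<And>x. x \<in> U \<Longrightarrow> inj (S x)"
    and S: "\<And>e. continuous_on U (\<lambda>x. S x e)" and b: "continuous_on U b"
    and y: "\<And>x. x \<in> U \<Longrightarrow> S x (y x) = b x"
  shows "continuous_on U y"
  unfolding continuous_on_def
proof
  fix x0 assume x0: "x0 \<in> U"
  obtain B where B: "B > 0" "\<And>e. B * norm e \<le> norm (S x0 e)"
    using linear_inj_bounded_below_pos assms(1,2)[OF x0] by metis
  define \<delta> where "\<delta> x = (\<Sum>e\<in>Basis. norm (S x e - S x0 e))" for x
  have \<delta>: "(\<delta> \<longlongrightarrow> 0) (at x0 within U)"
    unfolding \<delta>_def using S x0 unfolding continuous_on_def
    by (intro tendsto_null_sum tendsto_norm_zero LIM_zero) auto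
  have op: "norm (S x e - S x0 e) \<le> \<delta> x * norm e" if "x \<in> U" for x e
  proof -
    have "linear (\<lambda>e. S x e - S x0 e)" using assms(1) that x0 by (intro linear_compose_sub)
    then have "norm (S x e - S x0 e) = norm (\<Sum>i\<in>Basis. (e \<bullet> i) *\<^sub>R (S x i - S x0 i))"
      by (intro arg_cong[of _ _ norm]) (rule linear_basis_expansion)
    also have "\<dots> \<le> (\<Sum>i\<in>Basis. norm e * norm (S x i - S x0 i))"
      by (rule sum_norm_le) (auto intro!: mult_right_mono Basis_le_norm)
    finally show ?thesis by (simp add: \<delta>_def sum_distrib_left mult.commute)
  qed
  have "\<forall>\<^sub>F x in at x0 within U. \<delta> x < B / 2"
    using order_tendstoD(2)[OF \<delta>, of "B / 2"] B(1) by simp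
  moreover have "\<forall>\<^sub>F x in at x0 within U. x \<in> U" by (simp add: eventually_at_filter)
  ultimately have ev: "\<forall>\<^sub>F x in at x0 within U. norm (y x - y x0) \<le> 2 / B * norm (b x - S x (y x0))"
  proof eventually_elim
    case (elim x)
    let ?e = "y x - y x0"
    have "B * norm ?e \<le> norm (S x0 ?e)" using B by blast
    also have "\<dots> \<le> norm (S x ?e) + norm (S x ?e - S x0 ?e)" by (metis norm_triangle_sub norm_minus_commute)
    also have "\<dots> \<le> norm (b x - S x (y x0)) + B/2 * norm ?e"
      using op[OF elim(2), of ?e] y[OF elim(2)] elim(1) linear_diff[OF assms(1)[OF elim(2)]]
        mult_right_mono[of "\<delta> x" "B/2" "norm ?e"] by simp
    finally show ?case using B(1) by (simp add: field_simps)
  qed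
  have "((\<lambda>x. 2 / B * norm (b x - S x (y x0))) \<longlongrightarrow> 2 / B * norm (b x0 - S x0 (y x0))) (at x0 within U)"
    using S b x0 unfolding continuous_on_def by (intro tendsto_intros) auto
  then have "((\<lambda>x. y x - y x0) \<longlongrightarrow> 0) (at x0 within U)"
    by (intro Lim_null_comparison[OF ev]) (simp add: y x0)
  then show "(y \<longlongrightarrow> y x0) (at x0 within U)" by (simp add: LIM_zero_cancel)
qed

text \<open>Differentiating \<open>S x (y x) = b x\<close> gives a system for \<open>y'\<close> with the same operators \<open>S x\<close> and a right-hand side
  built from \<open>b'\<close>, \<open>S'\<close> and \<open>y\<close>; hence the induction over the order, for all right-hand sides at once.\<close>

lemma Ck_on_linear_solve:
  fixes y :: "'a::euclidean_space \<Rightarrow> 'b::euclidean_space" and S :: "'a \<Rightarrow> 'b \<Rightarrow> 'b"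
  assumes U: "open U" and lin: "\<And>x. x \<in> U \<Longrightarrow> linear (S x)" and inj: "\<And>x. x \<in> U \<Longrightarrow> inj (S x)"
  shows "(\<And>e. Ck_on k (\<lambda>x. S x e) U) \<Longrightarrow> Ck_on k b U \<Longrightarrow> (\<And>x. x \<in> U \<Longrightarrow> S x (y x) = b x) \<Longrightarrow> Ck_on k y U"
proof (induction k arbitrary: b y)
  case 0 then show ?case using continuous_on_linear_solve[of U S b y, OF lin inj] by simp
next
  case (Suc k)
  have S: "Ck_on k (\<lambda>x. S x e) U" for e using Suc.prems(1) Ck_on_SucD U by blast
  have b: "Ck_on k b U" using Suc.prems(2) Ck_on_SucD U by blast
  have y: "Ck_on k y U" using Suc.IH[OF S b] Suc.prems(3) by blast
  have dS: "((\<lambda>x. S x e) has_derivative Df (\<lambda>x. S x e) x) (at x)" if "x \<in> U" for x e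
    using Suc.prems(1) that unfolding Ck_on_Suc_iff[OF U] by auto
  have db: "(b has_derivative Df b x) (at x)" if "x \<in> U" for x
    using Suc.prems(2) that unfolding Ck_on_Suc_iff[OF U] by auto
  define rhs where "rhs x v = Df b x v - (\<Sum>e\<in>Basis. (y x \<bullet> e) *\<^sub>R Df (\<lambda>x. S x e) x v)" for x v
  define y' where "y' x v = inv (S x) (rhs x v)" for x v
  have surj: "surj (S x)" if "x \<in> U" for x
    using lin inj that linear_injective_imp_surjective by blast
  have Sy': "S x (y' x v) = rhs x v" if "x \<in> U" for x v
    unfolding y'_def using surj[OF that] surj_f_inv_f by metis
  show ?case
  proof (rule Ck_on_SucI[OF U, where f'=y'])
    fix x0 assume x0: "x0 \<in> U"
    obtain R where R: "linear R" "R \<circ> S x0 = id"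
      using linear_injective_left_inverse lin inj x0 by metis
    have Rinv: "R z = inv (S x0) z" for z
      using surj[OF x0] R(2) by (metis comp_apply id_apply surj_f_inv_f)
    have cont: "isCont y x0"
      using Ck_on_imp_continuous[OF U y] U x0 continuous_on_eq_continuous_at by blast
    \<comment> \<open>With the operator frozen at \<open>x0\<close>, the solution is \<open>y x = R (b x - (S x - S x0) (y x))\<close>. The
      perturbation vanishes at \<open>x0\<close>, so continuity of \<open>y\<close> suffices for differentiating this formula.\<close>
    have *: "((\<lambda>x. R (b x - (\<Sum>e\<in>Basis. (y x \<bullet> e) *\<^sub>R (S x e - S x0 e)))) has_derivative
       (\<lambda>v. R (Df b x0 v - (\<Sum>e\<in>Basis. (y x0 \<bullet> e) *\<^sub>R Df (\<lambda>x. S x e) x0 v)))) (at x0)"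
    proof (intro bounded_linear.has_derivative[of R] has_derivative_diff has_derivative_sum db x0
        has_derivative_scaleR_vanishing)
      show "bounded_linear R" using R linear_conv_bounded_linear by blast
      show "isCont (\<lambda>x. y x \<bullet> e) x0" for e using cont by (intro continuous_intros)
      show "((\<lambda>x. S x e - S x0 e) has_derivative Df (\<lambda>x. S x e) x0) (at x0)" for e
        using has_derivative_diff[OF dS[OF x0] has_derivative_const] by simp
    qed auto
    show "(y has_derivative y' x0) (at x0)"
    proof (rule has_derivative_transform_within_open[OF _ U x0])
      show "((\<lambda>x. R (b x - (\<Sum>e\<in>Basis. (y x \<bullet> e) *\<^sub>R (S x e - S x0 e)))) has_derivative y' x0) (at x0)"
        using * by (simp add: y'_def[abs_def] rhs_def Rinv)
      fix x assume x: "x \<in> U"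
      have "linear (\<lambda>e. S x e - S x0 e)" using lin x x0 by (intro linear_compose_sub)
      then have "(\<Sum>e\<in>Basis. (y x \<bullet> e) *\<^sub>R (S x e - S x0 e)) = S x (y x) - S x0 (y x)"
        by (rule linear_basis_expansion[symmetric])
      then have "b x - (\<Sum>e\<in>Basis. (y x \<bullet> e) *\<^sub>R (S x e - S x0 e)) = S x0 (y x)"
        using Suc.prems(3)[OF x] by simp
      then show "R (b x - (\<Sum>e\<in>Basis. (y x \<bullet> e) *\<^sub>R (S x e - S x0 e))) = y x"
        using R(2) by (metis comp_apply id_apply)
    qed
  next
    fix v
    have "Ck_on k (\<lambda>x. Df b x v + - 1 *\<^sub>R (\<Sum>e\<in>Basis. (y x \<bullet> e) *\<^sub>R Df (\<lambda>x. S x e) x v)) U"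
      using Suc.prems(1,2) unfolding Ck_on_Suc_iff[OF U]
      by (intro Ck_on_add Ck_on_scaleR Ck_on_const Ck_on_sum Ck_on_inner_left U y) auto
    then have "Ck_on k (\<lambda>x. rhs x v) U" by (simp add: rhs_def)
    then show "Ck_on k (\<lambda>x. y' x v) U" by (rule Suc.IH[OF S]) (rule Sy')
  qed
qed

lemma smooth_on_linear_solve:
  fixes y :: "'a::euclidean_space \<Rightarrow> 'b::euclidean_space" and S :: "'a \<Rightarrow> 'b \<Rightarrow> 'b"
  assumes "open U" "\<And>x. x \<in> U \<Longrightarrow> linear (S x)" "\<And>x. x \<in> U \<Longrightarrow> inj (S x)"
    "\<And>e. smooth_on U (\<lambda>x. S x e)" "smooth_on U b" "\<And>x. x \<in> U \<Longrightarrow> S x (y x) = b x"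
  shows "smooth_on U y"
  using assms(4,5) Ck_on_linear_solve[where y=y and S=S and b=b, OF assms(1-3) _ _ assms(6)]
  unfolding smooth_on_def by simp

text \<open>The classical inverse function theorem yields a differentiable inverse \<open>g\<close>. Its derivative
  solves the linear system \<open>Df f (g y) (g' y v) = v\<close>, whose operators are as smooth as \<open>g\<close>; so
  each order of smoothness of \<open>g\<close> yields the next.\<close>

theorem smooth_inverse_function:
  fixes f :: "'a::euclidean_space \<Rightarrow> 'a"
  assumes U: "open U" and f: "smooth_on U f" and x0: "x0 \<in> U" and id: "Df f x0 = id"
  obtains A B g where "open A" "A \<subseteq> U" "x0 \<in> A" "open B" "homeomorphism A B f g" "smooth_on B g"
proof -
  define f' where "f' x = Blinfun (Df f x)" for x
  have f': "blinfun_apply (f' x) = Df f x" if "x \<in> U" for x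
    unfolding f'_def using smooth_on_has_derivative[OF f U that] bounded_linear_Blinfun_apply
      has_derivative_bounded_linear by blast
  have cont: "continuous_on U f'"
  proof (rule continuous_on_blinfun_componentwise)
    fix i :: 'a
    show "continuous_on U (\<lambda>x. blinfun_apply (f' x) i)"
      using smooth_on_imp_continuous[OF smooth_on_Df[OF f U] U, of i] f' by (simp cong: continuous_on_cong)
  qed
  have "id_blinfun o\<^sub>L f' x0 = id_blinfun"
    by (rule blinfun_eqI) (simp add: f'[OF x0] id)
  then obtain A B g g' where A: "open A" "A \<subseteq> U" "x0 \<in> A" "open B" "f x0 \<in> B" "homeomorphism A B f g"
    and g: "\<And>y. y \<in> B \<Longrightarrow> (g has_derivative (g' y)) (at y)"
      "\<And>y. y \<in> B \<Longrightarrow> g' y = inv (blinfun_apply (f'(g y)))"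
      "\<And>y. y \<in> B \<Longrightarrow> bij (blinfun_apply (f'(g y)))"
    using inverse_function_theorem[OF U _ cont x0] smooth_on_has_derivative[OF f U] f' by metis
  have gB: "g ` B \<subseteq> U" using A unfolding homeomorphism_def by blast
  have f'g: "blinfun_apply (f' (g y)) = Df f (g y)" if "y \<in> B" for y using f' gB that by blast
  have "Ck_on k g B" for k
  proof (induction k)
    case 0 show ?case using A(6) by (simp add: homeomorphism_def)
  next
    case (Suc k)
    show ?case
    proof (rule Ck_on_SucI[OF A(4) g(1)])
      fix v
      show "Ck_on k (\<lambda>y. g' y v) B"
      proof (rule Ck_on_linear_solve[OF A(4), where S="\<lambda>y. Df f (g y)" and b="\<lambda>y. v"])
        show "linear (Df f (g y))" if "y \<in> B" for y
          using smooth_on_linear_Df[OF f U] gB that by blast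
        show "inj (Df f (g y))" if "y \<in> B" for y using g(3)[OF that] f'g[OF that] bij_is_inj by metis
        show "Ck_on k (\<lambda>y. Df f (g y) e) B" for e
          using Ck_on_compose[OF A(4) U gB Suc] smooth_on_Df[OF f U] unfolding smooth_on_def by blast
        show "Ck_on k (\<lambda>y. v) B" using A(4) by (rule Ck_on_const)
        show "Df f (g y) (g' y v) = v" if "y \<in> B" for y
          using g(2,3)[OF that] f'g[OF that] by (metis bij_is_surj surj_f_inv_f)
      qed
    qed
  qed
  then show thesis using that A unfolding smooth_on_def by blast
qed

section \<open>Smooth solutions of ordinary differential equations\<close>

text \<open>Picard iteration for a globally Lipschitz field, as a contraction of the space of bounded
  continuous functions on the whole line. Clamping the time to \<open>[-e, e]\<close> by \<open>cl\<close> turns functions on the interval into functions on the line.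
  Integrating from \<open>-e\<close> and subtracting the value at \<open>0\<close> covers both signs of the time;
  the two terms contribute at most \<open>2 e\<close> and \<open>e\<close>, whence the factor \<open>3\<close>.\<close>

lemma picard_global:
  fixes g :: "'a::euclidean_space \<Rightarrow> 'a"
  assumes lip: "\<And>x y. norm (g x - g y) \<le> K * norm (x - y)" and bd: "\<And>x. norm (g x) \<le> M"
    and e: "e > 0" "3 * e * K < 1" "K \<ge> 0"
  obtains y where "y 0 = x0" "\<And>t. norm (y t - x0) \<le> 3 * e * M"
    "\<And>t. t \<in> {-e<..<e} \<Longrightarrow> (y has_vector_derivative g (y t)) (at t)"
proof -
  define cl where "cl t = max (-e) (min e t)" for t
  have cl: "cl t \<in> {-e..e}" for t using e by (auto simp: cl_def)
  define J where "J u \<tau> = integral {-e..\<tau>} (\<lambda>s. g (apply_bcontfun u s))" for u :: "real \<Rightarrow>\<^sub>C 'a" and \<tau>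
  define F where "F u t = x0 + J u (cl t) - J u 0" for u t
  have gcont: "continuous_on X g" for X
  proof (rule continuous_on_subset)
    show "continuous_on UNIV g"
      by (rule lipschitz_on_continuous_on[of K], rule lipschitz_onI)
        (use lip e in \<open>auto simp: dist_norm\<close>)
  qed auto
  have gu: "continuous_on X (\<lambda>s. g (apply_bcontfun u s))" for u X
    by (rule continuous_on_compose2[OF gcont, where s = X and t = UNIV]) auto
  have Jdiff: "norm (J u \<tau> - J v \<tau>) \<le> K * dist u v * (\<tau> + e)" if "\<tau> \<in> {-e..e}" for u v \<tau>
  proof -
    have "J u \<tau> - J v \<tau> = integral {-e..\<tau>} (\<lambda>s. g (apply_bcontfun u s) - g (apply_bcontfun v s))"
      unfolding J_def by (subst integral_diff) (auto intro!: integrable_continuous_real gu)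
    also have "norm \<dots> \<le> K * dist u v * (\<tau> - (-e))"
    proof (rule integral_bound)
      show "continuous_on {-e..\<tau>} (\<lambda>s. g (apply_bcontfun u s) - g (apply_bcontfun v s))"
        by (intro continuous_on_diff gu)
      fix s
      have "norm (g (apply_bcontfun u s) - g (apply_bcontfun v s)) \<le> K * dist (apply_bcontfun u s) (apply_bcontfun v s)"
        using lip by (simp add: dist_norm)
      also have "\<dots> \<le> K * dist u v" using e dist_bounded by (intro mult_left_mono)
      finally show "norm (g (apply_bcontfun u s) - g (apply_bcontfun v s)) \<le> K * dist u v" .
    qed (use that in auto)
    finally show ?thesis by simp
  qed
  have Jbd: "norm (J u \<tau>) \<le> M * (\<tau> + e)" if "\<tau> \<in> {-e..e}" for u \<tau>
  proof -
    have "norm (J u \<tau>) \<le> M * (\<tau> - (-e))"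
      unfolding J_def by (rule integral_bound) (use that gu bd in auto)
    then show ?thesis by simp
  qed
  have M0: "M \<ge> 0" using bd[of 0] norm_ge_zero order_trans by blast
  have Fbd: "norm (F u t - x0) \<le> 3 * e * M" for u t
  proof -
    have "norm (F u t - x0) \<le> norm (J u (cl t)) + norm (J u 0)"
      unfolding F_def using norm_triangle_ineq4 by (metis add_diff_cancel_left' add_diff_eq)
    also have "\<dots> \<le> M * (cl t + e) + M * (0 + e)" using cl e by (intro add_mono Jbd) auto
    also have "\<dots> \<le> M * (2 * e) + M * e" using cl[of t] M0 by (intro add_mono mult_left_mono) auto
    finally show ?thesis by (simp add: algebra_simps)
  qed
  have Jcont: "continuous_on {-e..e} (J u)" for u
    unfolding J_def by (intro indefinite_integral_continuous_1 integrable_continuous_real gu)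
  have Fcont: "continuous_on UNIV (F u)" for u
  proof -
    have "continuous_on UNIV cl" unfolding cl_def by (intro continuous_intros)
    then have "continuous_on UNIV (\<lambda>t. J u (cl t))"
      by (rule continuous_on_compose2[OF Jcont]) (use cl in auto)
    then show ?thesis unfolding F_def by (intro continuous_intros)
  qed
  have Fb: "F u \<in> bcontfun" for u
  proof (rule bcontfun_normI[OF Fcont])
    show "norm (F u t) \<le> 3 * e * M + norm x0" for t
      using Fbd[of u t] norm_triangle_sub[of "F u t" x0] by linarith
  qed
  define T where "T u = Bcontfun (F u)" for u
  have T: "apply_bcontfun (T u) = F u" for u unfolding T_def using Fb by (rule Bcontfun_inverse)
  have contr: "dist (T u) (T v) \<le> 3 * e * K * dist u v" for u v
  proof (rule dist_bound)
    fix t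
    have "dist (F u t) (F v t) = norm ((J u (cl t) - J v (cl t)) - (J u 0 - J v 0))"
      by (simp add: dist_norm F_def algebra_simps)
    also have "\<dots> \<le> norm (J u (cl t) - J v (cl t)) + norm (J u 0 - J v 0)" by (rule norm_triangle_ineq4)
    also have "\<dots> \<le> K * dist u v * (cl t + e) + K * dist u v * (0 + e)"
      using cl e by (intro add_mono Jdiff) auto
    also have "\<dots> \<le> K * dist u v * (2 * e) + K * dist u v * e"
      using cl[of t] e by (intro add_mono mult_left_mono) auto
    finally show "dist (apply_bcontfun (T u) t) (apply_bcontfun (T v) t) \<le> 3 * e * K * dist u v"
      by (simp add: T algebra_simps)
  qed
  have "\<exists>!u. T u = u"
    by (rule banach_fix_type[of "3 * e * K"]) (use e contr in auto)
  then obtain u where u: "T u = u" by blast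
  then have uF: "apply_bcontfun u = F u" using T by metis
  show thesis
  proof (rule that[of "apply_bcontfun u"])
    have "cl 0 = 0" using e by (auto simp: cl_def)
    then show "apply_bcontfun u 0 = x0" by (simp add: uF F_def)
    show "norm (apply_bcontfun u t - x0) \<le> 3 * e * M" for t using Fbd uF by metis
    fix t assume t: "t \<in> {-e<..<e}"
    have "(J u has_vector_derivative g (apply_bcontfun u t)) (at t within {-e..e})"
      unfolding J_def by (rule integral_has_vector_derivative[OF gu]) (use t in auto)
    then have "(J u has_vector_derivative g (apply_bcontfun u t)) (at t)"
      using at_within_interior[of t "{-e..e}"] t by (simp add: interior_atLeastAtMost_real)
    then have "((\<lambda>t. x0 + J u t - J u 0) has_vector_derivative g (apply_bcontfun u t)) (at t)"
      by (auto intro!: derivative_eq_intros)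
    then show "(apply_bcontfun u has_vector_derivative g (apply_bcontfun u t)) (at t)"
      by (rule has_vector_derivative_transform_within_open[OF _ open_greaterThanLessThan t])
        (auto simp: uF F_def cl_def)
  qed
qed

lemma C1_lipschitz_on_compact_convex:
  fixes G :: "'a::euclidean_space \<Rightarrow> 'b::euclidean_space"
  assumes U: "open U" and G: "Ck_on (Suc 0) G U" and C: "compact C" "convex C" "C \<subseteq> U"
  obtains K where "K \<ge> 0" "\<And>x y. x \<in> C \<Longrightarrow> y \<in> C \<Longrightarrow> norm (G x - G y) \<le> K * norm (x - y)"
proof -
  have d: "(G has_derivative Df G x) (at x)" if "x \<in> U" for x
    using G that unfolding Ck_on_Suc_iff[OF U] by auto
  have c: "continuous_on U (\<lambda>x. Df G x b)" for b using G unfolding Ck_on_Suc_iff[OF U] by simp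
  have "bounded ((\<lambda>x. \<Sum>b\<in>Basis. norm (Df G x b)) ` C)"
    by (intro compact_imp_bounded compact_continuous_image C continuous_intros continuous_on_subset[OF c])
  then obtain K where K: "K > 0" "\<And>x. x \<in> C \<Longrightarrow> norm (\<Sum>b\<in>Basis. norm (Df G x b)) \<le> K"
    unfolding bounded_pos by blast
  have "onorm (Df G x) \<le> K" if "x \<in> C" for x
  proof (rule onorm_le)
    fix v
    have lin: "linear (Df G x)" using d C that has_derivative_linear by blast
    have "norm (Df G x v) = norm (\<Sum>b\<in>Basis. (v \<bullet> b) *\<^sub>R Df G x b)" using linear_basis_expansion[OF lin, of v] by (rule arg_cong)
    also have "\<dots> \<le> (\<Sum>b\<in>Basis. norm v * norm (Df G x b))"
      by (rule sum_norm_le) (auto intro!: mult_right_mono Basis_le_norm)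
    also have "\<dots> = (\<Sum>b\<in>Basis. norm (Df G x b)) * norm v" by (simp add: sum_distrib_left mult.commute)
    also have "\<dots> \<le> K * norm v" using K(2)[OF that] by (intro mult_right_mono) auto
    finally show "norm (Df G x v) \<le> K * norm v" .
  qed
  then have "norm (G x - G y) \<le> K * norm (x - y)" if "x \<in> C" "y \<in> C" for x y
    using differentiable_bound[OF C(2), of G "\<lambda>x. Df G x" K] d C that has_derivative_at_withinI by (metis subsetD)
  with K(1) show thesis using that[of K] by auto
qed

text \<open>Composing the field with the nearest-point projection onto a ball makes it globally Lipschitz
  and bounded; for short times the solution stays in the ball, where the projection is the
  identity.\<close>

lemma picard_local:
  fixes G :: "'a::euclidean_space \<Rightarrow> 'a"
  assumes U: "open U" and G: "Ck_on (Suc 0) G U" and x0: "x0 \<in> U"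
  obtains e y where "e > 0" "y 0 = x0" "\<And>t. t \<in> {-e<..<e} \<Longrightarrow> y t \<in> U"
    "\<And>t. t \<in> {-e<..<e} \<Longrightarrow> (y has_vector_derivative G (y t)) (at t)"
proof -
  obtain r where r: "r > 0" "cball x0 r \<subseteq> U" using U x0 open_contains_cball by blast
  let ?C = "cball x0 r"
  obtain K where K: "K \<ge> 0" "\<And>x y. x \<in> ?C \<Longrightarrow> y \<in> ?C \<Longrightarrow> norm (G x - G y) \<le> K * norm (x - y)"
    using C1_lipschitz_on_compact_convex[OF U G compact_cball convex_cball r(2)] by blast
  have "bounded (G ` ?C)"
    using Ck_on_imp_continuous[OF U G] r by (intro compact_imp_bounded compact_continuous_image) (auto intro: continuous_on_subset)
  then obtain M where M: "M > 0" "\<And>x. x \<in> ?C \<Longrightarrow> norm (G x) \<le> M" unfolding bounded_pos by blast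
  define P where "P = closest_point ?C"
  have P: "P x \<in> ?C" for x unfolding P_def using r by (intro closest_point_in_set) auto
  have Plip: "norm (P x - P y) \<le> norm (x - y)" for x y
    using closest_point_lipschitz[of ?C x y] r unfolding P_def dist_norm by auto
  \<comment> \<open>\<open>3 e K < 1\<close> makes the iteration a contraction, \<open>3 e M \<le> r\<close> keeps the solution in the ball.\<close>
  define e where "e = min (1 / (6 * K + 1)) (r / (3 * M)) / 2"
  have e: "e > 0" using K M r by (auto simp: e_def)
  have "e \<le> 1 / (6 * K + 1)" "e \<le> r / (3 * M)" using e unfolding e_def by linarith+
  then have eK: "3 * e * K < 1" and eM: "3 * e * M \<le> r"
    using K M e by (auto simp: field_simps)
  obtain y where y: "y 0 = x0" "\<And>t. norm (y t - x0) \<le> 3 * e * M"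
    "\<And>t. t \<in> {-e<..<e} \<Longrightarrow> (y has_vector_derivative G (P (y t))) (at t)"
  proof (rule picard_global[of "\<lambda>x. G (P x)" K M e x0])
    show "norm (G (P x) - G (P y)) \<le> K * norm (x - y)" for x y
      using K(2)[OF P P] Plip K(1) by (meson mult_left_mono order_trans)
    show "norm (G (P x)) \<le> M" for x using M P by blast
  qed (use e eK K that in auto)
  have yC: "y t \<in> ?C" for t using y(2)[of t] eM by (simp add: dist_norm norm_minus_commute)
  then have Py: "P (y t) = y t" for t unfolding P_def by (rule closest_point_self)
  show thesis
    by (rule that[of e y, OF e y(1)]) (use y(3) yC Py r(2) in \<open>auto simp: subset_iff\<close>)
qed

lemma Ck_on_real_derivative:
  assumes "open I" "\<And>t. t \<in> I \<Longrightarrow> (c has_vector_derivative c' t) (at t)" "Ck_on k c' I"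
  shows "Ck_on (Suc k) c I"
  by (rule Ck_on_SucI[OF assms(1), where f'="\<lambda>t v. v *\<^sub>R c' t"])
    (use assms in \<open>auto simp: has_vector_derivative_def simp del: Ck_on.simps
      intro!: Ck_on_scaleR Ck_on_const\<close>)

text \<open>If \<open>y\<close> is of class \<open>k\<close>, so is its derivative \<open>G (y t)\<close>, which puts \<open>y\<close> into class \<open>k + 1\<close>.\<close>

lemma smooth_on_ode_solution:
  fixes G :: "'a::euclidean_space \<Rightarrow> 'a"
  assumes U: "open U" and G: "smooth_on U G" and I: "open I" and "y ` I \<subseteq> U"
    and y: "\<And>t. t \<in> I \<Longrightarrow> (y has_vector_derivative G (y t)) (at t)"
  shows "smooth_on I y"
  unfolding smooth_on_def
proof
  show "Ck_on k y I" for k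
  proof (induction k)
    case 0
    have "isCont y t" if "t \<in> I" for t using y[OF that] by (rule has_vector_derivative_continuous)
    then show ?case by (simp add: continuous_at_imp_continuous_on)
  next
    case (Suc k)
    then have "Ck_on k (\<lambda>t. G (y t)) I"
      using Ck_on_compose[OF I U assms(4)] G unfolding smooth_on_def by blast
    then show ?case using Ck_on_real_derivative[OF I y] by blast
  qed
qed

theorem smooth_ode_solution:
  fixes G :: "'a::euclidean_space \<Rightarrow> 'a"
  assumes U: "open U" and G: "smooth_on U G" and x0: "x0 \<in> U"
  obtains e y where "e > 0" "y 0 = x0" "\<And>t. t \<in> {-e<..<e} \<Longrightarrow> y t \<in> U"
    "\<And>t. t \<in> {-e<..<e} \<Longrightarrow> (y has_vector_derivative G (y t)) (at t)" "smooth_on {-e<..<e} y"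
proof -
  obtain e y where *: "e > 0" "y 0 = x0" "\<And>t. t \<in> {-e<..<e} \<Longrightarrow> y t \<in> U"
    "\<And>t. t \<in> {-e<..<e} \<Longrightarrow> (y has_vector_derivative G (y t)) (at t)"
    using picard_local[OF U _ x0, of G] G unfolding smooth_on_def by blast
  have "smooth_on {-e<..<e} y"
    by (rule smooth_on_ode_solution[OF U G]) (use * in auto)
  with * show thesis using that by blast
qed

section \<open>Orthogonal projections and smooth curves\<close>

lemma orthogonal_projection_exists:
  fixes T :: "'a::euclidean_space set"
  assumes "subspace T"
  obtains pr where "linear pr" "\<And>x. pr x \<in> T" "\<And>x. x \<in> T \<Longrightarrow> pr x = x"
    "\<And>x y. y \<in> T \<Longrightarrow> (x - pr x) \<bullet> y = 0"
proof -
  obtain E where E: "E \<subseteq> T" "pairwise orthogonal E" "\<And>x. x \<in> E \<Longrightarrow> norm x = 1"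
    "independent E" "span E = T"
    using orthonormal_basis_subspace[OF assms] by metis
  define pr where "pr x = (\<Sum>b\<in>E. (x \<bullet> b) *\<^sub>R b)" for x
  have fin: "finite E" using E(4) by (rule independent_imp_finite)
  have lin: "linear pr" unfolding pr_def
    by (intro linearI) (simp_all add: inner_add_left scaleR_add_left sum.distrib scaleR_sum_right)
  have T: "pr x \<in> T" for x unfolding pr_def using E(1) assms
    by (intro subspace_sum) (auto intro: subspace_scale)
  have "(x - pr x) \<bullet> e = 0" if "e \<in> E" for x e
  proof -
    have "pr x \<bullet> e = (\<Sum>b\<in>E. (x \<bullet> b) * (b \<bullet> e))" by (simp add: pr_def inner_sum_left)
    also have "\<dots> = (\<Sum>b\<in>E. if b = e then x \<bullet> e else 0)"
      using E(2,3) that by (intro sum.cong) (auto simp: pairwise_def orthogonal_def norm_eq_1)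
    also have "\<dots> = x \<bullet> e" using fin that by simp
    finally show ?thesis by (simp add: inner_diff_left)
  qed
  then have orth: "(x - pr x) \<bullet> y = 0" if "y \<in> T" for x y
    using orthogonal_to_span[of y E "x - pr x"] E(5) that by (auto simp: orthogonal_def inner_commute)
  have "pr x = x" if "x \<in> T" for x
    using orth[of "x - pr x" x] subspace_diff[OF assms that T] by simp
  with lin T orth show thesis using that by blast
qed

lemma orth_proj_eqI:
  fixes S :: "'a::euclidean_space set"
  assumes "subspace S" "p \<in> S" "\<And>y. y \<in> S \<Longrightarrow> (x - p) \<bullet> y = 0"
  shows "orth_proj (\<bullet>) S x = p"
  unfolding orth_proj_def
proof (rule the_equality)
  fix q assume q: "q \<in> S \<and> (\<forall>y\<in>S. (x - q) \<bullet> y = 0)"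
  then have "q - p \<in> S" using assms subspace_diff by blast
  then have "(x - p) \<bullet> (q - p) = 0" "(x - q) \<bullet> (q - p) = 0" using q assms by auto
  then have "(q - p) \<bullet> (q - p) = 0" by (simp add: inner_diff_left)
  then show "q = p" by simp
qed (use assms in auto)

lemma orth_proj_properties:
  fixes S :: "'a::euclidean_space set"
  assumes "subspace S"
  shows "orth_proj (\<bullet>) S x \<in> S" and "y \<in> S \<Longrightarrow> (x - orth_proj (\<bullet>) S x) \<bullet> y = 0"
proof -
  obtain pr where "\<And>x. pr x \<in> S" "\<And>x y. y \<in> S \<Longrightarrow> (x - pr x) \<bullet> y = 0"
    using orthogonal_projection_exists[OF assms] by metis
  moreover then have "orth_proj (\<bullet>) S x = pr x" using orth_proj_eqI[OF assms] by metis
  ultimately show "orth_proj (\<bullet>) S x \<in> S" and "y \<in> S \<Longrightarrow> (x - orth_proj (\<bullet>) S x) \<bullet> y = 0" by auto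
qed

lemma orth_proj_scaleR:
  fixes S :: "'a::euclidean_space set"
  assumes "subspace S"
  shows "orth_proj (\<bullet>) S (r *\<^sub>R x) = r *\<^sub>R orth_proj (\<bullet>) S x"
proof (rule orth_proj_eqI[OF assms])
  show "r *\<^sub>R orth_proj (\<bullet>) S x \<in> S" using orth_proj_properties(1)[OF assms] assms by (rule subspace_scale[rotated])
  show "(r *\<^sub>R x - r *\<^sub>R orth_proj (\<bullet>) S x) \<bullet> y = 0" if "y \<in> S" for y
    using orth_proj_properties(2)[OF assms that, of x] by (simp flip: scaleR_diff_right)
qed

lemma has_vector_derivative_compose_smooth:
  assumes "smooth_on S f" "open S" "(c has_vector_derivative v) (at t)" "c t \<in> S"
  shows "((\<lambda>t. f (c t)) has_vector_derivative Df f (c t) v) (at t)"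
proof -
  have "((\<lambda>t. f (c t)) has_derivative (\<lambda>s. Df f (c t) (s *\<^sub>R v))) (at t)"
    using assms smooth_on_has_derivative
    by (intro has_derivative_compose[of c _ _ _ f]) (auto simp: has_vector_derivative_def)
  then show ?thesis
    using linear_scale[OF smooth_on_linear_Df[OF assms(1,2,4)]] by (simp add: has_vector_derivative_def)
qed

lemma second_derivative_expansion:
  assumes f: "smooth_on S f" and S: "open S" and x: "x \<in> S"
  shows "Df (\<lambda>y. Df f y w) x v = (\<Sum>b\<in>Basis. (w \<bullet> b) *\<^sub>R Df (\<lambda>y. Df f y b) x v)"
proof -
  have "((\<lambda>y. \<Sum>b\<in>Basis. (w \<bullet> b) *\<^sub>R Df f y b) has_derivative
      (\<lambda>v. \<Sum>b\<in>Basis. (w \<bullet> b) *\<^sub>R Df (\<lambda>y. Df f y b) x v)) (at x)"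
    using smooth_on_has_derivative[OF smooth_on_Df[OF f S] S x]
    by (intro has_derivative_sum has_derivative_scaleR_right) auto
  then have "((\<lambda>y. Df f y w) has_derivative (\<lambda>v. \<Sum>b\<in>Basis. (w \<bullet> b) *\<^sub>R Df (\<lambda>y. Df f y b) x v)) (at x)"
    by (rule has_derivative_transform_within_open[OF _ S x])
      (rule linear_basis_expansion[OF smooth_on_linear_Df[OF f S], symmetric])
  from Df_eq[OF this] show ?thesis by simp
qed

text \<open>The second-order chain rule. The first summand is the second derivative of \<open>f\<close>, applied to
  \<open>w t\<close> and \<open>c'\<close>; used with \<open>w\<close> the velocity of \<open>c\<close>, it describes the acceleration of \<open>f \<circ> c\<close>.\<close>

lemma has_vector_derivative_Df_along_curve:
  assumes f: "smooth_on S f" and S: "open S" and ct: "c t \<in> S"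
    and c: "(c has_vector_derivative c') (at t)" and w: "(w has_vector_derivative w') (at t)"
  shows "((\<lambda>s. Df f (c s) (w s)) has_vector_derivative
           Df (\<lambda>y. Df f y (w t)) (c t) c' + Df f (c t) w') (at t)"
proof -
  have "isCont c t" using c by (rule has_vector_derivative_continuous)
  then obtain N where N: "open N" "t \<in> N" "\<And>s. s \<in> N \<Longrightarrow> c s \<in> S"
    using S ct continuous_at_open[of t c] by metis
  have wb: "((\<lambda>s. w s \<bullet> b) has_vector_derivative w' \<bullet> b) (at t)" for b
    using bounded_linear.has_vector_derivative[OF bounded_linear_inner_left w] .
  have "((\<lambda>s. \<Sum>b\<in>Basis. (w s \<bullet> b) *\<^sub>R Df f (c s) b) has_vector_derivative
      (\<Sum>b\<in>Basis. (w t \<bullet> b) *\<^sub>R Df (\<lambda>y. Df f y b) (c t) c' + (w' \<bullet> b) *\<^sub>R Df f (c t) b)) (at t)"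
    using wb has_vector_derivative_compose_smooth[OF smooth_on_Df[OF f S] S c ct]
    by (intro has_vector_derivative_sum has_vector_derivative_scaleR)
      (auto simp: has_real_derivative_iff_has_vector_derivative)
  also have "(\<Sum>b\<in>Basis. (w t \<bullet> b) *\<^sub>R Df (\<lambda>y. Df f y b) (c t) c' + (w' \<bullet> b) *\<^sub>R Df f (c t) b)
     = Df (\<lambda>y. Df f y (w t)) (c t) c' + Df f (c t) w'"
    unfolding sum.distrib second_derivative_expansion[OF f S ct, symmetric]
      linear_basis_expansion[OF smooth_on_linear_Df[OF f S ct], symmetric] ..
  finally show ?thesis
    by (rule has_vector_derivative_transform_within_open[OF _ N(1,2)])
      (use N(3) linear_basis_expansion[OF smooth_on_linear_Df[OF f S], symmetric] in auto)
qed

lemma smooth_curve_velocity: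
  assumes "smooth_on I c" "open I"
  shows "t \<in> I \<Longrightarrow> (c has_vector_derivative velocity c t) (at t)" and "smooth_on I (velocity c)"
proof -
  have d: "(c has_vector_derivative Df c t 1) (at t)" if "t \<in> I" for t
  proof -
    have "Df c t = (\<lambda>s. s *\<^sub>R Df c t 1)"
    proof
      show "Df c t s = s *\<^sub>R Df c t 1" for s
        using linear_scale[OF smooth_on_linear_Df[OF assms that], of s 1] by simp
    qed
    then show ?thesis using smooth_on_has_derivative[OF assms that]
      by (simp add: has_vector_derivative_def)
  qed
  then have e: "Df c t 1 = velocity c t" if "t \<in> I" for t
    unfolding velocity_def using vector_derivative_at that by metis
  show "t \<in> I \<Longrightarrow> (c has_vector_derivative velocity c t) (at t)" using d e by metis
  show "smooth_on I (velocity c)"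
    by (rule smooth_on_cong[OF smooth_on_Df[OF assms] assms(2)]) (rule e)
qed

lemma smooth_curve_acceleration:
  assumes "smooth_on I c" "open I" "t \<in> I"
  shows "(velocity c has_vector_derivative acceleration c t) (at t)"
  using smooth_curve_velocity(1)[OF smooth_curve_velocity(2)[OF assms(1,2)] assms(2,3)]
  unfolding acceleration_def velocity_def[of "velocity c"] .

lemma vector_derivative_in_subspace:
  fixes Z :: "'a::euclidean_space set"
  assumes Z: "subspace Z" and I: "open I" "t \<in> I" "\<And>s. s \<in> I \<Longrightarrow> c s \<in> Z"
    and c: "(c has_vector_derivative v) (at t)"
  shows "v \<in> Z"
proof -
  obtain pr where pr: "linear pr" "\<And>x. pr x \<in> Z" "\<And>x. x \<in> Z \<Longrightarrow> pr x = x"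
    using orthogonal_projection_exists[OF Z] by metis
  have "((\<lambda>t. pr (c t)) has_vector_derivative pr v) (at t)"
    using c by (rule bounded_linear.has_vector_derivative[OF pr(1)[unfolded linear_conv_bounded_linear]])
  then have "(c has_vector_derivative pr v) (at t)"
    by (rule has_vector_derivative_transform_within_open[OF _ I(1,2)]) (use pr(3) I(3) in auto)
  then have "v = pr v" using c vector_derivative_unique_at by blast
  then show ?thesis using pr(2) by metis
qed

lemma open_line_preimage:
  fixes y \<eta> :: "'a::real_normed_vector"
  assumes "open N" shows "open {t::real. y + t *\<^sub>R \<eta> \<in> N}"
proof -
  have "open ((\<lambda>t::real. y + t *\<^sub>R \<eta>) -` N)"
    by (rule open_vimage[OF assms]) (intro continuous_intros)
  then show ?thesis by (simp add: vimage_def)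
qed

section \<open>Tangent spaces, accelerations and geodesics of a straightened submanifold\<close>

text \<open>An open piece of the linear space \<open>T\<close>, bent by a diffeomorphism \<open>h\<close> of ambient open sets: a
  submanifold covered by a single slice chart.\<close>

locale straightened_submanifold =
  fixes A B T :: "'a::euclidean_space set" and h \<phi> :: "'a \<Rightarrow> 'a"
  assumes open_A: "open A" and open_B: "open B" and hom: "homeomorphism B A h \<phi>"
    and smooth_h: "smooth_on B h" and smooth_\<phi>: "smooth_on A \<phi>" and T: "subspace T"
begin

definition M :: "'a set" where "M = h ` (B \<inter> T)"

lemma h_in: "x \<in> B \<Longrightarrow> h x \<in> A" and \<phi>_h: "x \<in> B \<Longrightarrow> \<phi> (h x) = x"
  and \<phi>_in: "y \<in> A \<Longrightarrow> \<phi> y \<in> B" and h_\<phi>: "y \<in> A \<Longrightarrow> h (\<phi> y) = y"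
  using hom unfolding homeomorphism_def by blast+

lemma M_subset: "M \<subseteq> A" using h_in by (auto simp: M_def)

lemma M_\<phi>: "y \<in> M \<Longrightarrow> \<phi> y \<in> B \<inter> T" by (auto simp: M_def \<phi>_h)

lemma smooth_submanifold_M: "smooth_submanifold M"
  unfolding smooth_submanifold_def
proof (intro exI[of _ "dim T"] ballI)
  fix p assume p: "p \<in> M"
  have "M \<inter> A = h ` (B \<inter> T)" using M_subset by (auto simp: M_def)
  then have "\<phi> ` (M \<inter> A) = (\<lambda>x. \<phi> (h x)) ` (B \<inter> T)" by (simp only: image_image)
  also have "\<dots> = B \<inter> T" using \<phi>_h by simp
  finally have "\<phi> ` (M \<inter> A) = B \<inter> T" .
  then show "\<exists>A (B :: 'a set) \<phi> \<psi> L.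
       open A \<and> p \<in> A \<and> open B \<and> homeomorphism A B \<phi> \<psi> \<and> smooth_on A \<phi> \<and> smooth_on B \<psi> \<and>
       subspace L \<and> dim L = dim T \<and> \<phi> ` (M \<inter> A) = B \<inter> L"
    using p M_subset open_A open_B homeomorphism_symD[OF hom] smooth_h smooth_\<phi> T by blast
qed

lemma Df_\<phi>_Df_h: assumes x: "x \<in> B" shows "Df \<phi> (h x) (Df h x v) = v"
proof -
  have "((\<lambda>x. \<phi> (h x)) has_derivative (\<lambda>v. Df \<phi> (h x) (Df h x v))) (at x)"
    using smooth_on_has_derivative[OF smooth_h open_B x]
      smooth_on_has_derivative[OF smooth_\<phi> open_A h_in[OF x]] by (rule has_derivative_compose)
  then have "((\<lambda>x. x) has_derivative (\<lambda>v. Df \<phi> (h x) (Df h x v))) (at x)"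
    by (rule has_derivative_transform_within_open[OF _ open_B x]) (rule \<phi>_h)
  from has_derivative_unique[OF this has_derivative_ident] show ?thesis by metis
qed

lemma Df_h_Df_\<phi>: assumes x: "x \<in> B" shows "Df h x (Df \<phi> (h x) w) = w"
proof -
  have "((\<lambda>y. h (\<phi> y)) has_derivative (\<lambda>v. Df h (\<phi> (h x)) (Df \<phi> (h x) v))) (at (h x))"
    using smooth_on_has_derivative[OF smooth_\<phi> open_A h_in[OF x]]
      smooth_on_has_derivative[OF smooth_h open_B \<phi>_in[OF h_in[OF x]]] by (rule has_derivative_compose)
  then have "((\<lambda>x. x) has_derivative (\<lambda>v. Df h (\<phi> (h x)) (Df \<phi> (h x) v))) (at (h x))"
    by (rule has_derivative_transform_within_open[OF _ open_A h_in[OF x]]) (rule h_\<phi>)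
  from has_derivative_unique[OF this has_derivative_ident] show ?thesis using \<phi>_h[OF x] by metis
qed

lemma restrict:
  assumes V: "open V" "V \<subseteq> B"
  shows "straightened_submanifold (h ` V) V T h \<phi>"
proof -
  have hV: "h ` V = A \<inter> \<phi> -` V" using V(2) h_in \<phi>_h h_\<phi> by (force intro: image_eqI)
  have "continuous_on A \<phi>" using hom by (simp add: homeomorphism_def)
  then have o: "open (h ` V)" unfolding hV using open_A V(1) by (rule continuous_open_preimage)
  show ?thesis
  proof (unfold_locales)
    show "homeomorphism V (h ` V) h \<phi>" using hom V(2) by (rule homeomorphism_of_subsets) (use hV in auto)
    show "smooth_on V h" using smooth_h V(2) by (rule smooth_on_subset)
    show "smooth_on (h ` V) \<phi>" using smooth_\<phi> by (rule smooth_on_subset) (use hV in auto)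
  qed (use V o T in auto)
qed

text \<open>The component of \<open>\<phi>\<close> orthogonal to \<open>T\<close> vanishes on \<open>M\<close>, and the kernel of its derivative
  is the tangent space.\<close>

lemma defining_function:
  obtains \<rho> :: "'a \<Rightarrow> 'a" where "smooth_on A \<rho>" "\<And>y. y \<in> M \<Longrightarrow> \<rho> y = 0"
    "\<And>x w. x \<in> B \<inter> T \<Longrightarrow> Df \<rho> (h x) w = 0 \<Longrightarrow> w \<in> Df h x ` T"
proof -
  obtain pr where pr: "linear pr" "\<And>x. pr x \<in> T" "\<And>x. x \<in> T \<Longrightarrow> pr x = x"
    using orthogonal_projection_exists[OF T] by metis
  define \<rho> where "\<rho> y = \<phi> y - pr (\<phi> y)" for y
  show thesis
  proof (rule that[of \<rho>])
    show "smooth_on A \<rho>" unfolding \<rho>_def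
      using open_A smooth_\<phi> smooth_on_linear_compose[OF open_A pr(1) smooth_\<phi>] by (rule smooth_on_diff)
    show "\<rho> y = 0" if "y \<in> M" for y using M_\<phi>[OF that] pr by (simp add: \<rho>_def)
    fix x w assume x: "x \<in> B \<inter> T" and 0: "Df \<rho> (h x) w = 0"
    have "(\<phi> has_derivative Df \<phi> (h x)) (at (h x))"
      using smooth_on_has_derivative[OF smooth_\<phi> open_A h_in] x by blast
    from has_derivative_diff[OF this bounded_linear.has_derivative[OF _ this, of pr]]
    have "(\<rho> has_derivative (\<lambda>w. Df \<phi> (h x) w - pr (Df \<phi> (h x) w))) (at (h x))"
      unfolding \<rho>_def[abs_def] using pr(1) by (simp add: linear_conv_bounded_linear)
    from Df_eq[OF this] 0 have "Df \<phi> (h x) w = pr (Df \<phi> (h x) w)" by simp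
    then have "Df \<phi> (h x) w \<in> T" using pr(2) by metis
    then show "w \<in> Df h x ` T" using Df_h_Df_\<phi>[of x w] x by (metis IntD1 imageI)
  qed
qed

lemma derivative_of_curve_in_M:
  assumes I: "open I" "t \<in> I" and c: "c ` I \<subseteq> M" "c t = h x" "x \<in> B \<inter> T"
    "(c has_vector_derivative v) (at t)"
  shows "v \<in> Df h x ` T"
proof -
  obtain \<rho> :: "'a \<Rightarrow> 'a" where \<rho>: "smooth_on A \<rho>" "\<And>y. y \<in> M \<Longrightarrow> \<rho> y = 0"
    "\<And>x w. x \<in> B \<inter> T \<Longrightarrow> Df \<rho> (h x) w = 0 \<Longrightarrow> w \<in> Df h x ` T"
    by (rule defining_function) blast
  have "((\<lambda>t. \<rho> (c t)) has_vector_derivative Df \<rho> (c t) v) (at t)"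
    using c h_in by (intro has_vector_derivative_compose_smooth[OF \<rho>(1) open_A]) auto
  then have "((\<lambda>t. 0) has_vector_derivative Df \<rho> (c t) v) (at t)"
    by (rule has_vector_derivative_transform_within_open[OF _ I]) (use \<rho>(2) c in auto)
  then have "Df \<rho> (h x) v = 0" using c(2) has_vector_derivative_const vector_derivative_unique_at by metis
  then show ?thesis using \<rho>(3) c(3) by blast
qed

lemma tangent_space_eq:
  assumes x: "x \<in> B \<inter> T"
  shows "tangent_space M (h x) = Df h x ` T"
proof
  show "tangent_space M (h x) \<subseteq> Df h x ` T"
  proof
    fix v assume "v \<in> tangent_space M (h x)"
    then obtain e c where "e > 0" "c ` {-e<..<e} \<subseteq> M" "c 0 = h x" "(c has_vector_derivative v) (at (0::real))"
      unfolding tangent_space_def by blast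
    then show "v \<in> Df h x ` T"
      using derivative_of_curve_in_M[of "{-e<..<e}" 0 c x v] x by auto
  qed
  show "Df h x ` T \<subseteq> tangent_space M (h x)"
  proof
    fix v assume "v \<in> Df h x ` T"
    then obtain \<tau> where \<tau>: "\<tau> \<in> T" "v = Df h x \<tau>" by blast
    define l where "l t = x + t *\<^sub>R \<tau>" for t :: real
    have "isCont l 0" unfolding l_def by (intro continuous_intros)
    then have "\<forall>\<^sub>F t in at 0. l t \<in> B"
      using x open_B topological_tendstoD[of l "x" "at 0" B] by (auto simp: isCont_def l_def)
    then obtain e where e: "e > 0" "\<And>t. t \<noteq> 0 \<Longrightarrow> dist t 0 < e \<Longrightarrow> l t \<in> B"
      unfolding eventually_at by auto
    have lB: "l t \<in> B \<inter> T" if "t \<in> {-e<..<e}" for t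
    proof -
      have "l t \<in> B" using e(2)[of t] that x by (cases "t = 0") (auto simp: l_def)
      moreover have "l t \<in> T" unfolding l_def using x \<tau> T by (auto intro: subspace_add subspace_scale)
      ultimately show ?thesis by blast
    qed
    have sl: "smooth_on {-e<..<e} l" unfolding l_def
      by (intro smooth_on_add smooth_on_const smooth_on_linear)
        (auto intro!: linearI simp: algebra_simps)
    have dl: "(l has_vector_derivative \<tau>) (at 0)" unfolding l_def
      by (auto intro!: derivative_eq_intros)
    have l0: "l 0 = x" by (simp add: l_def)
    show "v \<in> tangent_space M (h x)" unfolding tangent_space_def
    proof (intro CollectI exI[of _ e] exI[of _ "\<lambda>t. h (l t)"] conjI)
      show "smooth_on {-e<..<e} (\<lambda>t. h (l t))"
        by (rule smooth_on_compose[OF _ open_B _ sl smooth_h]) (use lB in auto)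
      show "(\<lambda>t. h (l t)) ` {-e<..<e} \<subseteq> M" using lB by (auto simp: M_def)
      show "((\<lambda>t. h (l t)) has_vector_derivative v) (at 0)"
        using has_vector_derivative_compose_smooth[OF smooth_h open_B dl] x \<tau>(2) by (simp add: l0)
    qed (use e l0 in auto)
  qed
qed

lemma subspace_tangent_space: "x \<in> B \<inter> T \<Longrightarrow> subspace (tangent_space M (h x))"
  using tangent_space_eq[of x] linear_subspace_image[OF smooth_on_linear_Df[OF smooth_h open_B] T, of x] by simp

text \<open>Along a curve \<open>c\<close> in \<open>M\<close> the equation \<open>\<rho> (c t) = 0\<close>, differentiated twice, expresses
  \<open>Df \<rho> (c 0)\<close> of the acceleration through the position and the velocity alone.\<close>

lemma acceleration_diff_tangent:
  assumes c: "smooth_on I c" "open I" "0 \<in> I" "c ` I \<subseteq> M"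
    and d: "smooth_on J d" "open J" "0 \<in> J" "d ` J \<subseteq> M"
    and eq: "c 0 = d 0" "velocity c 0 = velocity d 0"
  shows "acceleration c 0 - acceleration d 0 \<in> tangent_space M (c 0)"
proof -
  obtain x where x: "c 0 = h x" "x \<in> B \<inter> T" using c unfolding M_def by blast
  obtain \<rho> :: "'a \<Rightarrow> 'a" where \<rho>: "smooth_on A \<rho>" "\<And>y. y \<in> M \<Longrightarrow> \<rho> y = 0"
    "\<And>x w. x \<in> B \<inter> T \<Longrightarrow> Df \<rho> (h x) w = 0 \<Longrightarrow> w \<in> Df h x ` T"
    by (rule defining_function) blast
  have *: "Df (\<lambda>y. Df \<rho> y (velocity c 0)) (c 0) (velocity c 0) + Df \<rho> (c 0) (acceleration c 0) = 0"
    if c: "smooth_on I c" "open I" "0 \<in> I" "c ` I \<subseteq> M" for c I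
  proof -
    have cA: "c t \<in> A" if "t \<in> I" for t using c M_subset that by auto
    have zero: "Df \<rho> (c t) (velocity c t) = 0" if t: "t \<in> I" for t
    proof -
      have "((\<lambda>t. \<rho> (c t)) has_vector_derivative Df \<rho> (c t) (velocity c t)) (at t)"
        by (rule has_vector_derivative_compose_smooth[OF \<rho>(1) open_A smooth_curve_velocity(1)[OF c(1,2) t] cA[OF t]])
      then have "((\<lambda>t. 0) has_vector_derivative Df \<rho> (c t) (velocity c t)) (at t)"
        by (rule has_vector_derivative_transform_within_open[OF _ c(2) t]) (use \<rho>(2) c in auto)
      then show ?thesis using has_vector_derivative_const vector_derivative_unique_at by metis
    qed
    have "((\<lambda>s. Df \<rho> (c s) (velocity c s)) has_vector_derivative
         Df (\<lambda>y. Df \<rho> y (velocity c 0)) (c 0) (velocity c 0) + Df \<rho> (c 0) (acceleration c 0)) (at 0)"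
      using c by (intro has_vector_derivative_Df_along_curve[OF \<rho>(1) open_A cA])
        (auto intro: smooth_curve_velocity smooth_curve_acceleration)
    then have "((\<lambda>s. 0) has_vector_derivative
         Df (\<lambda>y. Df \<rho> y (velocity c 0)) (c 0) (velocity c 0) + Df \<rho> (c 0) (acceleration c 0)) (at 0)"
      by (rule has_vector_derivative_transform_within_open[OF _ c(2,3)]) (rule zero)
    then show ?thesis using has_vector_derivative_const vector_derivative_unique_at by metis
  qed
  have lin: "linear (Df \<rho> (h x))" using smooth_on_linear_Df[OF \<rho>(1) open_A h_in] x by blast
  have "Df \<rho> (h x) (acceleration c 0) = Df \<rho> (h x) (acceleration d 0)"
    using *[OF c] *[OF d] unfolding eq[symmetric] x(1) by (metis add_left_cancel)
  then have "Df \<rho> (h x) (acceleration c 0 - acceleration d 0) = 0"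
    using linear_diff[OF lin] by simp
  then show ?thesis using \<rho>(3) x tangent_space_eq by auto
qed

text \<open>The acceleration of a geodesic is orthogonal to the tangent space, and the curve \<open>d\<close> fixes
  its normal component.\<close>

theorem geodesic_acceleration:
  assumes c: "geodesic_from M p v I c"
    and d: "smooth_on J d" "open J" "0 \<in> J" "d ` J \<subseteq> M" "d 0 = p" "velocity d 0 = v"
  shows "acceleration c 0 = acceleration d 0 - orth_proj (\<bullet>) (tangent_space M p) (acceleration d 0)"
proof -
  have c': "smooth_on I c" "open I" "0 \<in> I" "c ` I \<subseteq> M" "c 0 = p" "velocity c 0 = v"
    "covariant_derivative M c (velocity c) 0 = 0"
    using c unfolding geodesic_from_def geodesic_on_def by auto
  obtain x where x: "p = h x" "x \<in> B \<inter> T" using c' unfolding M_def by blast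
  let ?S = "tangent_space M p"
  have S: "subspace ?S" using subspace_tangent_space x by blast
  have "orth_proj (\<bullet>) ?S (acceleration c 0) = 0"
    using c'(5,7) unfolding covariant_derivative_def acceleration_def by simp
  then have perp: "acceleration c 0 \<bullet> y = 0" if "y \<in> ?S" for y
    using orth_proj_properties(2)[OF S that, of "acceleration c 0"] by simp
  have "acceleration c 0 - acceleration d 0 \<in> ?S"
    using acceleration_diff_tangent[OF c'(1-4) d(1-4)] c' d by simp
  then have "- (acceleration c 0 - acceleration d 0) \<in> ?S" using S subspace_neg by blast
  then have "orth_proj (\<bullet>) ?S (acceleration d 0) = acceleration d 0 - acceleration c 0"
    by (intro orth_proj_eqI[OF S]) (use perp in auto)
  then show ?thesis by simp
qed

text \<open>The second derivative of \<open>h\<close> at \<open>x\<close>, applied to \<open>w\<close> twice.\<close>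

definition h'' :: "'a \<Rightarrow> 'a \<Rightarrow> 'a" where
  "h'' x w = Df (\<lambda>y. Df h y w) x w"

lemma h''_expansion:
  assumes "x \<in> B"
  shows "h'' x w = (\<Sum>b\<in>Basis. (w \<bullet> b) *\<^sub>R (\<Sum>b'\<in>Basis. (w \<bullet> b') *\<^sub>R Df (\<lambda>y. Df h y b) x b'))"
proof -
  have "h'' x w = (\<Sum>b\<in>Basis. (w \<bullet> b) *\<^sub>R Df (\<lambda>y. Df h y b) x w)"
    unfolding h''_def by (rule second_derivative_expansion[OF smooth_h open_B assms])
  also have "\<dots> = (\<Sum>b\<in>Basis. (w \<bullet> b) *\<^sub>R (\<Sum>b'\<in>Basis. (w \<bullet> b') *\<^sub>R Df (\<lambda>y. Df h y b) x b'))"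
    by (intro sum.cong refl arg_cong[where f="scaleR _"]
      linear_basis_expansion[OF smooth_on_linear_Df[OF smooth_on_Df[OF smooth_h open_B] open_B assms]])
  finally show ?thesis .
qed

text \<open>The adjoint of \<open>Df h x\<close>, in coordinates that show its smooth dependence on \<open>x\<close>.\<close>

definition adj :: "'a \<Rightarrow> 'a \<Rightarrow> 'a" where
  "adj x z = (\<Sum>b\<in>Basis. (Df h x b \<bullet> z) *\<^sub>R b)"

lemma adj_inner:
  assumes "x \<in> B" shows "adj x z \<bullet> e = Df h x e \<bullet> z"
proof -
  have "Df h x e = (\<Sum>b\<in>Basis. (e \<bullet> b) *\<^sub>R Df h x b)"
    by (rule linear_basis_expansion[OF smooth_on_linear_Df[OF smooth_h open_B assms]])
  then have "Df h x e \<bullet> z = (\<Sum>b\<in>Basis. (e \<bullet> b) * (Df h x b \<bullet> z))"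
    by (simp only: inner_sum_left inner_scaleR_left)
  moreover have "adj x z \<bullet> e = (\<Sum>b\<in>Basis. (Df h x b \<bullet> z) * (b \<bullet> e))"
    by (simp only: adj_def inner_sum_left inner_scaleR_left)
  ultimately show ?thesis by (simp add: inner_commute mult.commute)
qed

lemma linear_adj: "linear (adj x)"
  unfolding adj_def
  by (intro linearI) (simp_all add: inner_add_right scaleR_add_left sum.distrib scaleR_sum_right)

text \<open>For a curve \<open>u\<close> in \<open>B \<inter> T\<close>, the curve \<open>h \<circ> u\<close> has acceleration \<open>h'' u u' + Df h u u''\<close>, so the geodesic equation demands that this
  be orthogonal to \<open>Df h u ` T\<close>. The lemma solves this demand for \<open>u'' = \<gamma> (u, u')\<close>, smoothly.\<close>

lemma geodesic_vector_field:
  obtains \<gamma> :: "'a \<times> 'a \<Rightarrow> 'a" where "smooth_on (B \<times> UNIV) \<gamma>"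
    "\<And>u w. u \<in> B \<Longrightarrow> \<gamma> (u, w) \<in> T"
    "\<And>u w \<tau>. u \<in> B \<Longrightarrow> \<tau> \<in> T \<Longrightarrow> (h'' u w + Df h u (\<gamma> (u, w))) \<bullet> Df h u \<tau> = 0"
proof -
  obtain pr where pr: "linear pr" "\<And>x. pr x \<in> T" "\<And>x. x \<in> T \<Longrightarrow> pr x = x"
    "\<And>x y. y \<in> T \<Longrightarrow> (x - pr x) \<bullet> y = 0"
    using orthogonal_projection_exists[OF T] by metis
  \<comment> \<open>On \<open>T\<close> the operator \<open>S u\<close> is the Gram operator of the restriction of \<open>Df h u\<close> to \<open>T\<close>; adding the identity on the
    orthogonal complement makes it invertible on the whole space, so that \<open>smooth_on_linear_solve\<close> applies.\<close>
  define S where "S u e = pr (adj u (Df h u (pr e))) + (e - pr e)" for u e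
  define \<gamma> where "\<gamma> u w = inv (S u) (- pr (adj u (h'' u w)))" for u w
  have linDh: "linear (Df h u)" if "u \<in> B" for u using smooth_on_linear_Df[OF smooth_h open_B that] .
  have linS: "linear (S u)" if "u \<in> B" for u
    unfolding S_def
    using linear_compose[OF linear_compose[OF linear_compose[OF pr(1) linDh[OF that]] linear_adj[of u]] pr(1)]
    by (intro linear_compose_add linear_compose_sub linear_id[unfolded id_def] pr(1)) (auto simp: o_def linear_ident)
  have injS: "inj (S u)" if u: "u \<in> B" for u
  proof (subst linear_injective_0[OF linS[OF u]], intro allI impI)
    fix e assume 0: "S u e = 0"
    let ?p = "pr (adj u (Df h u (pr e)))"
    have "(e - pr e) \<bullet> (e - pr e) = (e - pr e) \<bullet> (S u e - ?p)" by (simp add: S_def)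
    also have "\<dots> = 0" using pr(2,4) 0 by (simp add: inner_diff_right)
    finally have e: "pr e = e" by simp
    then have "?p = 0" using 0 by (simp add: S_def)
    then have "adj u (Df h u e) \<bullet> e = 0" using pr(4)[of e "adj u (Df h u e)"] pr(2)[of e] e by simp
    then have "Df h u e = 0" by (simp add: adj_inner[OF u])
    then show "e = 0" using Df_\<phi>_Df_h[OF u, of e] Df_\<phi>_Df_h[OF u, of 0] linear_0[OF linDh[OF u]] by simp
  qed
  have S\<gamma>: "S u (\<gamma> u w) = - pr (adj u (h'' u w))" if "u \<in> B" for u w
  proof -
    have "surj (S u)" using linS injS that linear_injective_imp_surjective by blast
    then show ?thesis unfolding \<gamma>_def by (rule surj_f_inv_f)
  qed
  have \<gamma>T: "\<gamma> u w \<in> T" if u: "u \<in> B" for u w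
  proof -
    have "S u (\<gamma> u w) \<in> T" using S\<gamma>[OF u] pr(2) T subspace_neg by metis
    then have "S u (\<gamma> u w) - pr (adj u (Df h u (pr (\<gamma> u w)))) + pr (\<gamma> u w) \<in> T"
      using T pr(2) by (intro subspace_add subspace_diff)
    then show ?thesis by (simp add: S_def)
  qed
  have orth: "(h'' u w + Df h u (\<gamma> u w)) \<bullet> Df h u \<tau> = 0" if u: "u \<in> B" and \<tau>: "\<tau> \<in> T" for u w \<tau>
  proof -
    let ?z = "h'' u w + Df h u (\<gamma> u w)"
    have "pr (adj u ?z) = pr (adj u (h'' u w)) + pr (adj u (Df h u (\<gamma> u w)))"
      by (simp add: linear_add[OF linear_adj] linear_add[OF pr(1)])
    also have "\<dots> = 0" using S\<gamma>[OF u, of w] pr(3)[OF \<gamma>T[OF u]] by (simp add: S_def)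
    finally have "pr (adj u ?z) = 0" .
    then have "adj u ?z \<bullet> \<tau> = 0" using pr(4)[OF \<tau>, of "adj u ?z"] by simp
    then show ?thesis unfolding adj_inner[OF u] by (simp only: inner_commute)
  qed
  let ?\<Omega> = "B \<times> (UNIV :: 'a set)"
  have \<Omega>: "open ?\<Omega>" using open_B by (intro open_Times) auto
  have sfst: "smooth_on ?\<Omega> fst" and ssnd: "smooth_on ?\<Omega> snd"
    using \<Omega> by (auto intro!: smooth_on_linear simp: linear_fst linear_snd)
  have lift: "smooth_on ?\<Omega> (\<lambda>p. g (fst p))" if "smooth_on B g" for g :: "'a \<Rightarrow> 'a"
    by (rule smooth_on_compose[OF \<Omega> open_B _ sfst that]) auto
  have sDh: "smooth_on ?\<Omega> (\<lambda>p. Df h (fst p) e)" for e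
    using lift[OF smooth_on_Df[OF smooth_h open_B]] .
  have sadj: "smooth_on ?\<Omega> (\<lambda>p. adj (fst p) (z p))" if "smooth_on ?\<Omega> z" for z
    unfolding adj_def
    by (intro smooth_on_sum smooth_on_scaleR smooth_on_inner sDh that smooth_on_const \<Omega>)
  have sD2: "smooth_on ?\<Omega> (\<lambda>p. Df (\<lambda>y. Df h y b) (fst p) b')" for b b'
    using lift[OF smooth_on_Df[OF smooth_on_Df[OF smooth_h open_B] open_B]] .
  have "smooth_on ?\<Omega> (\<lambda>p. \<Sum>b\<in>Basis. (snd p \<bullet> b) *\<^sub>R (\<Sum>b'\<in>Basis. (snd p \<bullet> b') *\<^sub>R Df (\<lambda>y. Df h y b) (fst p) b'))"
    by (intro smooth_on_sum smooth_on_scaleR smooth_on_inner sD2 smooth_on_const \<Omega> ssnd)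
  then have sh'': "smooth_on ?\<Omega> (\<lambda>p. h'' (fst p) (snd p))"
    by (rule smooth_on_cong[OF _ \<Omega>]) (auto simp: h''_expansion)
  have spr: "smooth_on ?\<Omega> (\<lambda>p. pr (z p))" if "smooth_on ?\<Omega> z" for z
    using \<Omega> pr(1) that by (rule smooth_on_linear_compose)
  have "smooth_on ?\<Omega> (\<lambda>p. \<gamma> (fst p) (snd p))"
  proof (rule smooth_on_linear_solve[OF \<Omega>, where S="\<lambda>p. S (fst p)" and b="\<lambda>p. - pr (adj (fst p) (h'' (fst p) (snd p)))"])
    show "smooth_on ?\<Omega> (\<lambda>p. S (fst p) e)" for e
      unfolding S_def using smooth_on_add[OF \<Omega> spr[OF sadj[OF sDh]] smooth_on_const[OF \<Omega>]] .
    show "smooth_on ?\<Omega> (\<lambda>p. - pr (adj (fst p) (h'' (fst p) (snd p))))"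
      using smooth_on_uminus[OF \<Omega> spr[OF sadj[OF sh'']]] .
  qed (use linS injS S\<gamma> in auto)
  then show thesis
  proof (rule that)
    show "\<gamma> (fst (u, w)) (snd (u, w)) \<in> T" if "u \<in> B" for u w
      using \<gamma>T[OF that] by (simp only: fst_conv snd_conv)
    show "(h'' u w + Df h u (\<gamma> (fst (u, w)) (snd (u, w)))) \<bullet> Df h u \<tau> = 0" if "u \<in> B" "\<tau> \<in> T" for u w \<tau>
      using orth[OF that] by (simp only: fst_conv snd_conv)
  qed
qed

text \<open>The geodesic equation as the first-order system \<open>u' = w\<close>, \<open>w' = \<gamma> (u, w)\<close> in the ambient
  coordinates; its solutions stay in \<open>T\<close> because \<open>\<gamma>\<close> takes values in \<open>T\<close>.\<close>

theorem geodesic_exists: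
  assumes a: "a \<in> B \<inter> T" and \<tau>: "\<tau> \<in> T"
  obtains I c where "geodesic_from M (h a) (Df h a \<tau>) I c"
proof -
  obtain \<gamma> :: "'a \<times> 'a \<Rightarrow> 'a" where \<gamma>: "smooth_on (B \<times> UNIV) \<gamma>"
    "\<And>u w. u \<in> B \<Longrightarrow> \<gamma> (u, w) \<in> T"
    "\<And>u w \<tau>. u \<in> B \<Longrightarrow> \<tau> \<in> T \<Longrightarrow> (h'' u w + Df h u (\<gamma> (u, w))) \<bullet> Df h u \<tau> = 0"
    by (rule geodesic_vector_field) (rule that)
  let ?\<Omega> = "B \<times> (UNIV :: 'a set)"
  have \<Omega>: "open ?\<Omega>" using open_B by (intro open_Times) auto
  define G where "G p = (snd p, \<gamma> p)" for p
  have "smooth_on ?\<Omega> (\<lambda>p. (snd p, 0) + (0, \<gamma> p))"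
  proof (rule smooth_on_add[OF \<Omega>])
    show "smooth_on ?\<Omega> (\<lambda>p. (snd p, 0 :: 'a))"
      using \<Omega> by (rule smooth_on_linear) (auto intro!: linearI)
    show "smooth_on ?\<Omega> (\<lambda>p. (0 :: 'a, \<gamma> p))"
      by (rule smooth_on_linear_compose[OF \<Omega> _ \<gamma>(1), of "Pair 0"]) (auto intro!: linearI)
  qed
  then have "smooth_on ?\<Omega> G" unfolding G_def by simp
  moreover have "(a, \<tau>) \<in> ?\<Omega>" using a by auto
  ultimately obtain e y where e: "e > 0" and y: "y 0 = (a, \<tau>)" "\<And>t. t \<in> {-e<..<e} \<Longrightarrow> y t \<in> ?\<Omega>"
    "\<And>t. t \<in> {-e<..<e} \<Longrightarrow> (y has_vector_derivative G (y t)) (at t)" "smooth_on {-e<..<e} y"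
    using smooth_ode_solution[OF \<Omega>] by blast
  let ?I = "{-e<..<e}"
  define u w where "u t = fst (y t)" and "w t = snd (y t)" for t
  have uB: "u t \<in> B" if "t \<in> ?I" for t using y(2)[OF that] by (auto simp: u_def)
  have u': "(u has_vector_derivative w t) (at t)" if "t \<in> ?I" for t
    using bounded_linear.has_vector_derivative[OF bounded_linear_fst y(3)[OF that]]
    by (simp add: u_def[abs_def] w_def G_def)
  have w': "(w has_vector_derivative \<gamma> (u t, w t)) (at t)" if "t \<in> ?I" for t
    using bounded_linear.has_vector_derivative[OF bounded_linear_snd y(3)[OF that]]
    by (simp add: u_def w_def[abs_def] G_def)
  have stays: "f t \<in> T" if f: "f 0 \<in> T" "\<And>t. t \<in> ?I \<Longrightarrow> (f has_vector_derivative f' t) (at t)"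
    "\<And>t. t \<in> ?I \<Longrightarrow> f' t \<in> T" and t: "t \<in> ?I" for f f' :: "real \<Rightarrow> 'a" and t
  proof -
    obtain pr where pr: "linear pr" "\<And>x. pr x \<in> T" "\<And>x. x \<in> T \<Longrightarrow> pr x = x"
      using orthogonal_projection_exists[OF T] by metis
    have bl: "bounded_linear (\<lambda>x. x - pr x)"
      using pr(1) by (intro bounded_linear_sub bounded_linear_ident) (simp add: linear_conv_bounded_linear)
    have "\<exists>k. \<forall>t\<in>?I. f t - pr (f t) = k"
    proof (rule has_vector_derivative_zero_constant)
      fix t assume t: "t \<in> ?I"
      have "((\<lambda>t. f t - pr (f t)) has_vector_derivative f' t - pr (f' t)) (at t)"
        using bounded_linear.has_vector_derivative[OF bl f(2)[OF t]] .
      then show "((\<lambda>t. f t - pr (f t)) has_vector_derivative 0) (at t within ?I)"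
        using pr(3)[OF f(3)[OF t]] by (auto intro: has_vector_derivative_at_within)
    qed auto
    then have "f t - pr (f t) = f 0 - pr (f 0)" using t e by force
    then have "f t = pr (f t)" using pr(3)[OF f(1)] by simp
    then show ?thesis using pr(2) by metis
  qed
  have wT: "w t \<in> T" if "t \<in> ?I" for t
    using stays[of w "\<lambda>t. \<gamma> (u t, w t)"] w' \<gamma>(2) uB y(1) \<tau> that by (simp add: w_def)
  have uT: "u t \<in> T" if "t \<in> ?I" for t
    using stays[of u w] u' wT y(1) a that by (simp add: u_def)
  define c where "c t = h (u t)" for t
  have su: "smooth_on ?I u" unfolding u_def[abs_def]
    using smooth_on_linear_compose[OF open_greaterThanLessThan linear_fst y(4)] .
  have sc: "smooth_on ?I c" unfolding c_def[abs_def]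
    by (rule smooth_on_compose[OF _ open_B _ su smooth_h]) (use uB in auto)
  have c': "(c has_vector_derivative Df h (u t) (w t)) (at t)" if "t \<in> ?I" for t
    unfolding c_def[abs_def] by (rule has_vector_derivative_compose_smooth[OF smooth_h open_B u'[OF that] uB[OF that]])
  then have vel: "velocity c t = Df h (u t) (w t)" if "t \<in> ?I" for t
    unfolding velocity_def using that by (intro vector_derivative_at)
  have acc: "(velocity c has_vector_derivative h'' (u t) (w t) + Df h (u t) (\<gamma> (u t, w t))) (at t)" if t: "t \<in> ?I" for t
    unfolding h''_def
    by (rule has_vector_derivative_transform_within_open[OF
       has_vector_derivative_Df_along_curve[OF smooth_h open_B uB[OF t] u'[OF t] w'[OF t]]
       open_greaterThanLessThan t])
      (rule vel[symmetric])
  have "covariant_derivative M c (velocity c) t = 0" if t: "t \<in> ?I" for t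
  proof -
    have x: "u t \<in> B \<inter> T" using uB uT t by blast
    have "orth_proj (\<bullet>) (tangent_space M (h (u t))) (h'' (u t) (w t) + Df h (u t) (\<gamma> (u t, w t))) = 0"
      by (rule orth_proj_eqI[OF subspace_tangent_space[OF x]])
        (use x \<gamma>(3) T tangent_space_eq[OF x] subspace_tangent_space[OF x] in \<open>auto simp: subspace_0\<close>)
    then show ?thesis
      unfolding covariant_derivative_def vector_derivative_at[OF acc[OF t]] by (simp add: c_def)
  qed
  moreover have "c ` ?I \<subseteq> M" using uB uT by (auto simp: M_def c_def)
  moreover have "0 \<in> ?I" using e by simp
  ultimately have "geodesic_from M (h a) (Df h a \<tau>) ?I c"
    unfolding geodesic_from_def geodesic_on_def
    using sc vel y(1) by (auto simp: is_interval_oo c_def u_def w_def)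
  then show thesis using that by blast
qed

end

section \<open>The image of a map of constant rank\<close>

text \<open>A linear map that does not lower the dimension of \<open>W\<close>: a right inverse has an image in \<open>W\<close> of full
  dimension, hence equal to \<open>W\<close>.\<close>

lemma surjective_imp_injective_on_subspace:
  fixes p :: "'a::euclidean_space \<Rightarrow> 'b::euclidean_space"
  assumes p: "linear p" and W: "subspace W" and dim: "dim W \<le> dim (p ` W)" and w: "w \<in> W" "p w = 0"
  shows "w = 0"
proof -
  obtain g where g: "range g \<subseteq> W" "linear g" "\<And>v. v \<in> p ` W \<Longrightarrow> p (g v) = v"
    using real_vector.linear_exists_right_inverse_on[OF p W] by blast
  have inj: "inj_on g (p ` W)" using g(3) by (metis inj_on_def)
  have sub: "subspace (p ` W)" using p W by (rule linear_subspace_image)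
  then have "span (p ` W) = p ` W" using span_eq_iff by blast
  then have "dim (g ` p ` W) = dim (p ` W)"
    using inj by (intro dim_image_eq[OF g(2)]) (simp only:)
  then have "g ` p ` W = W"
    using g(1) dim by (intro subspace_dim_equal[OF linear_subspace_image[OF g(2) sub] W]) auto
  then obtain v where "v \<in> p ` W" "w = g v" using w by blast
  then show ?thesis using g w linear_0 by metis
qed

text \<open>Write \<open>L\<close> for the derivative at \<open>z0\<close>, \<open>T\<close> for the image of \<open>Z\<close> under \<open>L\<close>, \<open>pr\<close> for the orthogonal projection onto \<open>T\<close> and
  \<open>s\<close> for a right inverse of \<open>L\<close> with values in \<open>Z\<close>. The slice \<open>a \<mapsto> f (z0 + s a)\<close> with \<open>a\<close> in \<open>T\<close>, thickened by the orthogonal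
  complement of \<open>T\<close>, is a local diffeomorphism \<open>h\<close> with inverse \<open>\<phi>\<close>. It remains to see that on \<open>Z\<close> near
  \<open>z0\<close> the map \<open>f\<close> takes no values outside \<open>h ` T\<close>. In coordinates \<open>y = G x\<close> of the domain in which the \<open>T\<close>-component of
  \<open>\<phi> \<circ> f\<close> becomes the linear map \<open>L\<close>, let \<open>k\<close> be \<open>\<phi> \<circ> f\<close>. Its derivative maps \<open>Z\<close> onto a space which \<open>pr\<close> maps onto \<open>T\<close>. By
  the bound on the rank it has at most the dimension of \<open>T\<close>, so \<open>pr\<close> is injective on it, and the
  derivative of \<open>k\<close> vanishes on the vectors of \<open>Z\<close> that \<open>L\<close> annihilates. Thus \<open>k\<close> is constant along the
  kernel of \<open>L\<close> in \<open>Z\<close>, and moving into the slice along this kernel gives \<open>k y = L y\<close>.\<close>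

theorem constant_rank_image:
  fixes f :: "'x::euclidean_space \<Rightarrow> 'a::euclidean_space"
  assumes f: "smooth_on UNIV f" and Z: "subspace Z" and z0: "z0 \<in> Z"
    and rank: "\<And>z. z \<in> Z \<Longrightarrow> dim (Df f z ` Z) \<le> dim (Df f z0 ` Z)"
  obtains A B h \<phi> U0 where "straightened_submanifold A B (Df f z0 ` Z) h \<phi>" "0 \<in> B" "h 0 = f z0"
    "Df h 0 = id" "openin (top_of_set Z) U0" "z0 \<in> U0"
    "\<And>U. openin (top_of_set Z) U \<Longrightarrow> z0 \<in> U \<Longrightarrow> U \<subseteq> U0 \<Longrightarrow>
       \<exists>V. open V \<and> 0 \<in> V \<and> V \<subseteq> B \<and> f ` U = h ` (V \<inter> Df f z0 ` Z)"
proof -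
  define L where "L = Df f z0"
  define T where "T = L ` Z"
  have df: "(f has_derivative Df f x) (at x)" for x using smooth_on_has_derivative[OF f] by auto
  have L: "linear L" unfolding L_def using smooth_on_linear_Df[OF f] by auto
  have T: "subspace T" unfolding T_def using L Z by (rule linear_subspace_image)
  have LT: "L z \<in> T" if "z \<in> Z" for z using that by (simp add: T_def)
  obtain pr where pr: "linear pr" "\<And>x. pr x \<in> T" "\<And>x. x \<in> T \<Longrightarrow> pr x = x"
    using orthogonal_projection_exists[OF T] by metis
  obtain g where g: "range g \<subseteq> Z" "linear g" "\<And>v. v \<in> L ` Z \<Longrightarrow> L (g v) = v"
    using real_vector.linear_exists_right_inverse_on[OF L Z] by blast
  define s where "s x = g (pr x)" for x
  have s: "linear s" unfolding s_def using linear_compose[OF pr(1) g(2)] by (simp add: o_def)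
  have sZ: "s x \<in> Z" for x using g(1) by (auto simp: s_def)
  have Ls: "L (s x) = pr x" for x using g(3) pr(2) by (simp add: s_def T_def)
  have spr: "s (pr x) = s x" for x using pr by (simp add: s_def)

  define h where "h x = f (z0 + s x) + (x - pr x)" for x
  have aff: "smooth_on UNIV (\<lambda>x. z0 + s x)" using s by (intro smooth_on_add smooth_on_const smooth_on_linear) auto
  have "smooth_on UNIV (\<lambda>x. f (z0 + s x))"
    by (rule smooth_on_compose[OF open_UNIV open_UNIV _ aff f]) auto
  moreover have "smooth_on UNIV (\<lambda>x. x - pr x)"
    using linear_compose_sub[OF linear_ident pr(1)] by (intro smooth_on_linear) auto
  ultimately have sh: "smooth_on UNIV h" unfolding h_def by (intro smooth_on_add) auto
  have h0: "h 0 = f z0" using linear_0[OF s] linear_0[OF pr(1)] by (simp add: h_def)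
  have "(h has_derivative (\<lambda>v. L (s v) + (v - pr v))) (at 0)"
    unfolding h_def
  proof (rule has_derivative_add)
    have "((\<lambda>x. z0 + s x) has_derivative s) (at 0)"
      using has_derivative_add[OF has_derivative_const bounded_linear_imp_has_derivative[of s]] s
      by (simp add: linear_conv_bounded_linear)
    moreover have "(f has_derivative L) (at (z0 + s 0))" using df linear_0[OF s] by (simp add: L_def)
    ultimately show "((\<lambda>x. f (z0 + s x)) has_derivative (\<lambda>v. L (s v))) (at 0)" by (rule has_derivative_compose)
    show "((\<lambda>x. x - pr x) has_derivative (\<lambda>v. v - pr v)) (at 0)"
      using bounded_linear_imp_has_derivative[of pr] pr(1)
      by (intro has_derivative_diff has_derivative_ident) (simp add: linear_conv_bounded_linear)
  qed
  then have Dh0: "Df h 0 = id" unfolding Ls by (subst Df_eq) (auto simp: id_def)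
  obtain B A \<phi> where BA: "open B" "0 \<in> B" "open A" "homeomorphism B A h \<phi>" "smooth_on A \<phi>"
    using smooth_inverse_function[OF open_UNIV sh UNIV_I Dh0] by metis
  interpret h: straightened_submanifold A B T h \<phi>
    by unfold_locales (use BA T smooth_on_subset[OF sh] in auto)
  have D\<phi>: "(\<phi> has_derivative id) (at (f z0))"
  proof -
    have "(\<phi> has_derivative Df \<phi> (h 0)) (at (h 0))"
      using smooth_on_has_derivative[OF BA(5,3) h.h_in[OF BA(2)]] .
    moreover have "Df \<phi> (h 0) = id" using h.Df_\<phi>_Df_h[OF BA(2)] Dh0 by fastforce
    ultimately show ?thesis using h0 by simp
  qed

  define D where "D = f -` A"
  have D: "open D" unfolding D_def
    using smooth_on_imp_continuous[OF f] BA(3) by (intro open_vimage) auto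
  have z0D: "z0 \<in> D" using h.h_in[OF BA(2)] h0 by (simp add: D_def)
  have sk: "smooth_on D (\<lambda>x. \<phi> (f x))"
    by (rule smooth_on_compose[OF D BA(3) _ smooth_on_subset[OF f] BA(5)]) (auto simp: D_def)
  have lin1: "linear (\<lambda>x. x - s (L x))"
    using linear_compose_sub[OF linear_ident linear_compose[OF L s]] by (simp add: o_def)
  \<comment> \<open>On \<open>Z\<close>, the map \<open>s \<circ> L\<close> is a projection along the kernel of \<open>L\<close>. \<open>G\<close> replaces the component
    of \<open>x - z0\<close> in its range by \<open>s (\<phi> (f x))\<close>, which agrees with it to first order.\<close>
  define G where "G x = s (\<phi> (f x)) + ((x - z0) - s (L (x - z0)))" for x
  have G_eq: "G x = s (\<phi> (f x)) + ((x - s (L x)) - (z0 - s (L z0)))" for x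
    using linear_diff[OF lin1, of x z0] by (simp add: G_def)
  have sG: "smooth_on D G" unfolding G_eq[abs_def]
    using smooth_on_add[OF D smooth_on_linear_compose[OF D s sk]
        smooth_on_diff[OF D smooth_on_linear[OF D lin1] smooth_on_const[OF D]]] .
  have "(G has_derivative (\<lambda>v. s (id (L v)) + ((v - s (L v)) - 0))) (at z0)"
    unfolding G_eq[abs_def]
  proof (intro has_derivative_add has_derivative_diff has_derivative_const)
    have "((\<lambda>x. \<phi> (f x)) has_derivative (\<lambda>v. id (L v))) (at z0)"
      using df D\<phi> unfolding L_def by (rule has_derivative_compose)
    then show "((\<lambda>x. s (\<phi> (f x))) has_derivative (\<lambda>v. s (id (L v)))) (at z0)"
      by (rule bounded_linear.has_derivative[OF s[unfolded linear_conv_bounded_linear]])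
    have "((\<lambda>x. s (L x)) has_derivative (\<lambda>x. s (L x))) (at z0)"
      using linear_compose[OF L s] by (intro bounded_linear_imp_has_derivative) (simp add: o_def linear_conv_bounded_linear)
    then show "((\<lambda>x. s (L x)) has_derivative (\<lambda>x. s (L x))) (at z0)" .
  qed auto
  then have DG: "Df G z0 = id" by (subst Df_eq) (auto simp: id_def)
  obtain A1 B1 H where AB1: "open A1" "A1 \<subseteq> D" "z0 \<in> A1" "open B1" "homeomorphism A1 B1 G H" "smooth_on B1 H"
    using smooth_inverse_function[OF D sG z0D DG] by metis
  have GB1: "G x \<in> B1" and HG: "H (G x) = x" if "x \<in> A1" for x
    using AB1(5) that unfolding homeomorphism_def by blast+
  have HA1: "H y \<in> A1" and GH: "G (H y) = y" if "y \<in> B1" for y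
    using AB1(5) that unfolding homeomorphism_def by blast+
  have G0: "G z0 = 0" using h.\<phi>_h[OF BA(2)] h0 linear_0[OF s] linear_0[OF L] by (simp add: G_def)
  have B10: "0 \<in> B1" using GB1[OF AB1(3)] G0 by simp
  have GZ: "G x \<in> Z \<longleftrightarrow> x \<in> Z" for x
  proof -
    have "G x = x + (s (\<phi> (f x)) - s (L (x - z0)) - z0)" by (simp add: G_def)
    moreover have "s (\<phi> (f x)) - s (L (x - z0)) - z0 \<in> Z" using sZ z0 Z by (intro subspace_diff)
    ultimately show ?thesis using Z by (metis add_diff_cancel_right' subspace_add subspace_diff)
  qed
  have LG: "L (G z) = pr (\<phi> (f z))" if "z \<in> Z" for z
  proof -
    have "pr (L (z - z0)) = L (z - z0)" using that z0 Z by (intro pr(3) LT subspace_diff)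
    then show ?thesis by (simp add: G_def linear_add[OF L] linear_diff[OF L] Ls)
  qed
  define k where "k y = \<phi> (f (H y))" for y
  have prk: "pr (k y) = L y" if "y \<in> B1" "y \<in> Z" for y
    using LG[of "H y"] GZ[of "H y"] GH[OF that(1)] that(2) by (simp add: k_def)
  have Hsa: "H (s a) = z0 + s a" "k (s a) = a" if a: "a \<in> T" "a \<in> B" "z0 + s a \<in> A1" for a
  proof -
    have fa: "f (z0 + s a) = h a" using pr(3)[OF a(1)] by (simp add: h_def)
    have "G (z0 + s a) = s a" using h.\<phi>_h[OF a(2)] Ls[of a] spr by (simp add: G_def fa)
    then show *: "H (s a) = z0 + s a" using HG[OF a(3)] by simp
    show "k (s a) = a" unfolding k_def * fa using h.\<phi>_h[OF a(2)] .
  qed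
  have skB1: "smooth_on B1 k" unfolding k_def[abs_def]
    by (rule smooth_on_compose[OF AB1(4) D _ AB1(6) sk]) (use HA1 AB1(2) in auto)
  have line: "((\<lambda>t. y + t *\<^sub>R \<eta>) has_vector_derivative \<eta>) (at t)" for y \<eta> :: 'x and t
    by (auto intro!: derivative_eq_intros)
  have Dk: "Df k y \<eta> = 0" if y: "y \<in> B1" "y \<in> Z" and \<eta>: "\<eta> \<in> Z" "L \<eta> = 0" for y \<eta>
  proof -
    have lineI: "open {t::real. y + t *\<^sub>R \<eta> \<in> B1}" "0 \<in> {t::real. y + t *\<^sub>R \<eta> \<in> B1}" for \<eta>
      using open_line_preimage[OF AB1(4)] y by auto
    have prDk: "pr (Df k y \<eta>) = L \<eta>" if "\<eta> \<in> Z" for \<eta>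
    proof -
      have "((\<lambda>t. k (y + t *\<^sub>R \<eta>)) has_vector_derivative Df k y \<eta>) (at 0)"
        using has_vector_derivative_compose_smooth[OF skB1 AB1(4) line[of y \<eta> 0]] y by simp
      then have "((\<lambda>t. pr (k (y + t *\<^sub>R \<eta>))) has_vector_derivative pr (Df k y \<eta>)) (at 0)"
        by (rule bounded_linear.has_vector_derivative[OF pr(1)[unfolded linear_conv_bounded_linear]])
      then have "((\<lambda>t. L y + t *\<^sub>R L \<eta>) has_vector_derivative pr (Df k y \<eta>)) (at 0)"
      proof (rule has_vector_derivative_transform_within_open[OF _ lineI])
        fix t assume "t \<in> {t::real. y + t *\<^sub>R \<eta> \<in> B1}"
        moreover have "y + t *\<^sub>R \<eta> \<in> Z" using y that Z by (intro subspace_add subspace_scale)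
        ultimately show "pr (k (y + t *\<^sub>R \<eta>)) = L y + t *\<^sub>R L \<eta>"
          using prk by (simp add: linear_add[OF L] linear_scale[OF L])
      qed
      moreover have "((\<lambda>t. L y + t *\<^sub>R L \<eta>) has_vector_derivative L \<eta>) (at 0)"
        by (auto intro!: derivative_eq_intros)
      ultimately show ?thesis using vector_derivative_unique_at by blast
    qed
    have DH: "Df H y \<eta> \<in> Z" if "\<eta> \<in> Z" for \<eta>
    proof (rule vector_derivative_in_subspace[OF Z lineI])
      show "((\<lambda>t. H (y + t *\<^sub>R \<eta>)) has_vector_derivative Df H y \<eta>) (at 0)"
        using has_vector_derivative_compose_smooth[OF AB1(6,4) line[of y \<eta> 0]] y by simp
      fix t assume "t \<in> {t::real. y + t *\<^sub>R \<eta> \<in> B1}"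
      moreover have "y + t *\<^sub>R \<eta> \<in> Z" using y that Z by (intro subspace_add subspace_scale)
      ultimately show "H (y + t *\<^sub>R \<eta>) \<in> Z" using GZ[of "H (y + t *\<^sub>R \<eta>)"] GH by simp
    qed
    have HyA: "f (H y) \<in> A" using HA1[OF y(1)] AB1(2) by (auto simp: D_def)
    have lin\<phi>: "linear (Df \<phi> (f (H y)))" using smooth_on_linear_Df[OF BA(5,3) HyA] .
    have linf: "linear (Df f (H y))" using smooth_on_linear_Df[OF f] by auto
    have "(k has_derivative (\<lambda>v. Df \<phi> (f (H y)) (Df f (H y) (Df H y v)))) (at y)"
      unfolding k_def
      using has_derivative_compose[OF has_derivative_compose[OF smooth_on_has_derivative[OF AB1(6,4) y(1)] df]
          smooth_on_has_derivative[OF BA(5,3) HyA]] .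
    from Df_eq[OF this] have "Df k y ` Z \<subseteq> Df \<phi> (f (H y)) ` Df f (H y) ` Z" using DH by auto
    then have "dim (Df k y ` Z) \<le> dim (Df \<phi> (f (H y)) ` Df f (H y) ` Z)" by (rule dim_subset)
    also have "\<dots> \<le> dim (Df f (H y) ` Z)" using lin\<phi> by (rule dim_image_le)
    also have "\<dots> \<le> dim T"
      unfolding T_def L_def using y GZ[of "H y"] GH[OF y(1)] by (intro rank) simp
    also have "T = pr ` Df k y ` Z" using prDk by (force simp: T_def image_image)
    finally show ?thesis
      using surjective_imp_injective_on_subspace[OF pr(1) linear_subspace_image[OF smooth_on_linear_Df[OF skB1 AB1(4) y(1)] Z]]
        prDk[OF \<eta>(1)] \<eta> by simp
  qed
  obtain r where r: "r > 0" "ball 0 r \<subseteq> B1" using AB1(4) B10 open_contains_ball by blast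
  \<comment> \<open>For \<open>y\<close> in \<open>W\<close> the segment from \<open>y\<close> to the slice point \<open>s (L y)\<close> stays in the domain of \<open>k\<close>, and the
    value of \<open>k\<close> at the slice point is known.\<close>
  define W where "W = ball 0 r \<inter> ((\<lambda>y. s (L y)) -` ball 0 r \<inter> (L -` B \<inter> (\<lambda>y. z0 + s (L y)) -` A1))"
  have contL: "continuous_on X L" and conts: "continuous_on Y s" for X Y
    using L s by (auto intro: linear_continuous_on simp: linear_conv_bounded_linear)
  have contsL: "continuous_on UNIV (\<lambda>y. s (L y))"
    by (rule continuous_on_compose2[OF conts contL]) auto
  have W: "open W" unfolding W_def
    by (intro open_Int open_ball open_vimage contL contsL BA(1) AB1(1) continuous_on_add continuous_on_const)
  have W0: "0 \<in> W" using r BA(2) AB1(3) linear_0[OF s] linear_0[OF L] by (simp add: W_def)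
  have kL: "k y = L y" if y: "y \<in> W" "y \<in> Z" for y
  proof -
    let ?\<eta> = "s (L y) - y"
    have \<eta>: "?\<eta> \<in> Z" "L ?\<eta> = 0"
      using sZ y Z pr(3)[OF LT[OF y(2)]] by (auto simp: subspace_diff linear_diff[OF L] Ls)
    have seg: "y + t *\<^sub>R ?\<eta> \<in> B1" "y + t *\<^sub>R ?\<eta> \<in> Z" if "t \<in> {0..1}" for t
    proof -
      have "y \<in> ball 0 r" "s (L y) \<in> ball 0 r" using y by (auto simp: W_def)
      then have "(1 - t) *\<^sub>R y + t *\<^sub>R s (L y) \<in> ball 0 r" using that by (intro convexD_alt[OF convex_ball]) auto
      also have "(1 - t) *\<^sub>R y + t *\<^sub>R s (L y) = y + t *\<^sub>R ?\<eta>" by (simp add: algebra_simps)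
      finally show "y + t *\<^sub>R ?\<eta> \<in> B1" using r by blast
      show "y + t *\<^sub>R ?\<eta> \<in> Z" using y \<eta> Z by (intro subspace_add subspace_scale)
    qed
    have "\<exists>c. \<forall>t\<in>{0..1}. k (y + t *\<^sub>R ?\<eta>) = c"
    proof (rule has_vector_derivative_zero_constant)
      fix t :: real assume t: "t \<in> {0..1}"
      have "((\<lambda>t. k (y + t *\<^sub>R ?\<eta>)) has_vector_derivative Df k (y + t *\<^sub>R ?\<eta>) ?\<eta>) (at t)"
        using has_vector_derivative_compose_smooth[OF skB1 AB1(4) line seg(1)[OF t]] .
      then show "((\<lambda>t. k (y + t *\<^sub>R ?\<eta>)) has_vector_derivative 0) (at t within {0..1})"
        using Dk[OF seg[OF t] \<eta>] by (simp add: has_vector_derivative_at_within)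
    qed auto
    then have "k (y + 0 *\<^sub>R ?\<eta>) = k (y + 1 *\<^sub>R ?\<eta>)" by (metis atLeastAtMost_iff order_refl zero_le_one)
    then have "k y = k (s (L y))" by simp
    also have "\<dots> = L y" using y LT by (intro Hsa) (auto simp: W_def)
    finally show ?thesis .
  qed
  define U0 where "U0 = Z \<inter> (A1 \<inter> G -` W)"
  have contG: "continuous_on A1 G" and contH: "continuous_on B1 H"
    using AB1(5) by (auto simp: homeomorphism_def)
  have "open (A1 \<inter> G -` W)" using contG AB1(1) W by (rule continuous_open_preimage)
  then have U0: "openin (top_of_set Z) U0" unfolding U0_def by (rule openin_open_Int)
  have z0U0: "z0 \<in> U0" using z0 AB1(3) W0 G0 by (simp add: U0_def)
  show thesis
  proof (rule that[OF h.straightened_submanifold_axioms[unfolded T_def L_def] BA(2) h0 Dh0 U0 z0U0])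
    fix U assume U: "openin (top_of_set Z) U" "z0 \<in> U" "U \<subseteq> U0"
    obtain U' where U': "open U'" "U = Z \<inter> U'" using U(1) openin_open by metis
    define N where "N = B1 \<inter> H -` U'"
    have N: "open N" unfolding N_def using contH AB1(4) U'(1) by (rule continuous_open_preimage)
    \<comment> \<open>A small change \<open>\<tau> - L (G x)\<close> within \<open>T\<close> of the value at \<open>x\<close> is realised by moving \<open>G x\<close> by \<open>s (\<tau> - L (G x))\<close>;
      hence the values \<open>L (G x)\<close> form an open subset of \<open>T\<close>.\<close>
    define V where "V = B \<inter> (\<Union>x\<in>U. (\<lambda>\<tau>. G x + s (\<tau> - L (G x))) -` N)"
    have "open ((\<lambda>\<tau>. G x + s (\<tau> - L (G x))) -` N)" for x
    proof (rule open_vimage[OF N])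
      have "continuous_on UNIV (\<lambda>\<tau>. s (\<tau> - L (G x)))"
        by (rule continuous_on_compose2[OF conts[of UNIV]]) (auto intro!: continuous_intros)
      then show "continuous_on UNIV (\<lambda>\<tau>. G x + s (\<tau> - L (G x)))" by (intro continuous_intros)
    qed
    then have oV: "open V" unfolding V_def using BA(1) by blast
    have Ux: "x \<in> A1" "G x \<in> W" "G x \<in> Z" "x \<in> Z" if "x \<in> U" for x
      using that U(3) GZ by (auto simp: U0_def)
    have VT: "V \<inter> T = (\<lambda>x. L (G x)) ` U"
    proof
      show "(\<lambda>x. L (G x)) ` U \<subseteq> V \<inter> T"
      proof (rule image_subsetI)
        fix x assume x: "x \<in> U"
        have "G x \<in> N" using Ux[OF x] x GB1 HG U'(2) by (simp add: N_def)
        then have "L (G x) \<in> (\<lambda>\<tau>. G x + s (\<tau> - L (G x))) -` N" using linear_0[OF s] by simp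
        moreover have "L (G x) \<in> B" using Ux[OF x] by (simp add: W_def)
        ultimately show "L (G x) \<in> V \<inter> T"
          unfolding V_def using x LT[OF Ux(3)[OF x]] by (intro IntI UN_I)
      qed
      show "V \<inter> T \<subseteq> (\<lambda>x. L (G x)) ` U"
      proof
        fix \<tau> assume \<tau>: "\<tau> \<in> V \<inter> T"
        then obtain x where x: "x \<in> U" "G x + s (\<tau> - L (G x)) \<in> N" by (auto simp: V_def)
        let ?y = "G x + s (\<tau> - L (G x))"
        have y: "?y \<in> B1" "H ?y \<in> U'" using x by (auto simp: N_def)
        have "?y \<in> Z" using Ux[OF x(1)] sZ Z by (intro subspace_add)
        then have HU: "H ?y \<in> U" using GZ[of "H ?y"] GH[OF y(1)] y(2) U'(2) by simp
        have "L ?y = \<tau>"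
          using \<tau> LT[OF Ux(3)[OF x(1)]] T pr(3)[of "\<tau> - L (G x)"] by (simp add: linear_add[OF L] Ls subspace_diff)
        then have "\<tau> = L (G (H ?y))" using GH[OF y(1)] by simp
        then show "\<tau> \<in> (\<lambda>x. L (G x)) ` U" using HU by (rule image_eqI)
      qed
    qed
    have fx: "f x = h (L (G x))" if "x \<in> U" for x
    proof -
      have "\<phi> (f x) = L (G x)" using kL[OF Ux(2,3)[OF that]] HG[OF Ux(1)[OF that]] by (simp add: k_def)
      moreover have "f x \<in> A" using Ux(1)[OF that] AB1(2) by (auto simp: D_def)
      ultimately show ?thesis using h.h_\<phi> by metis
    qed
    have "f ` U = h ` (V \<inter> T)" unfolding VT image_image using fx by (rule image_cong[OF refl])
    moreover have "0 \<in> V \<inter> T" unfolding VT using U(2) G0 linear_0[OF L] by force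
    ultimately show "\<exists>V. open V \<and> 0 \<in> V \<and> V \<subseteq> B \<and> f ` U = h ` (V \<inter> Df f z0 ` Z)"
      using oV unfolding T_def L_def by (intro exI[of _ V]) (auto simp: V_def)
  qed
qed

section \<open>Real and complex matrix subspaces\<close>

lemma cscale_of_real: "cscale (complex_of_real r) A = r *\<^sub>R A"
  by (simp add: cscale_def vec_eq_iff scaleR_conv_of_real[where 'a = complex])

lemma cmat_subspace_imp_subspace:
  assumes "cmat_subspace S" shows "subspace S"
proof (rule subspaceI)
  show "c *\<^sub>R x \<in> S" if "x \<in> S" for c x
    using cmat.subspace_scale[OF assms that, of "complex_of_real c"] by (simp add: cscale_of_real)
qed (use assms in \<open>auto intro: cmat.subspace_0 cmat.subspace_add\<close>)

lemma cscale_complex: "cscale (Complex a b) A = a *\<^sub>R A + b *\<^sub>R cscale \<i> A"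
  by (simp add: cscale_def vec_eq_iff complex_eq_iff)

text \<open>If \<open>B\<close> is a complex basis, then \<open>B\<close> together with \<open>\<i> B\<close> is a real basis: real combinations of
  the latter are complex combinations of \<open>B\<close>, coefficients \<open>a\<close> of \<open>b\<close> and \<open>a'\<close> of \<open>\<i> b\<close> forming \<open>a + \<i> a'\<close>.\<close>

lemma dim_eq_twice_cmat_dim:
  assumes S: "cmat_subspace S"
  shows "dim S = 2 * cmat_dim S"
proof -
  obtain B where B: "B \<subseteq> S" "\<not> cmat_dependent B" "S \<subseteq> cmat_span B" "card B = cmat_dim S"
    by (rule cmat.basis_exists)
  let ?J = "cscale \<i>"
  have indep: "u v = 0" if "finite t" "t \<subseteq> B" "(\<Sum>v\<in>t. cscale (u v) v) = 0" "v \<in> t" for t u v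
    using B(2) that unfolding cmat.independent_explicit_module by blast
  have "independent B"
    unfolding independent_explicit_module
  proof (intro allI impI)
    fix t u v assume t: "finite t" "t \<subseteq> B" "(\<Sum>v\<in>t. u v *\<^sub>R v) = 0" "v \<in> t"
    then have "complex_of_real (u v) = 0"
      by (intro indep[of t "\<lambda>v. complex_of_real (u v)" v]) (auto simp: cscale_of_real)
    then show "u v = 0" by simp
  qed
  then have fin: "finite B" by (rule independent_imp_finite)
  have JJ: "?J (?J x) = - x" for x by (simp add: cscale_def vec_eq_iff)
  then have injJ: "inj_on ?J X" for X by (metis inj_onI minus_minus)
  have disj: "B \<inter> ?J ` B = {}"
  proof (rule ccontr)
    assume "B \<inter> ?J ` B \<noteq> {}"
    then obtain b where b: "b \<in> B" "?J b \<in> B" by auto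
    show False
    proof (cases "?J b = b")
      case True
      then have "- b = b" using JJ[of b] by simp
      then have "2 *\<^sub>R b = 0" unfolding scaleR_2 by (metis add.left_inverse)
      then have "b = 0" by simp
      then show False using indep[of "{b}" "\<lambda>_. 1" b] b by (auto simp: cscale_def vec_eq_iff)
    next
      case False
      have "(\<Sum>v\<in>{b, ?J b}. cscale (if v = b then \<i> else - 1) v) = ?J b + cscale (- 1) (?J b)"
        using False by auto
      also have "\<dots> = 0" by (simp add: cscale_def vec_eq_iff)
      finally show False using indep[of "{b, ?J b}" "\<lambda>v. if v = b then \<i> else - 1" b] b by auto
    qed
  qed
  let ?C = "B \<union> ?J ` B"
  have finC: "finite ?C" using fin by simp
  have cardC: "card ?C = 2 * card B"
    using disj fin card_image[OF injJ, of B] by (simp add: card_Un_disjoint)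
  have sum_C: "(\<Sum>v\<in>?C. u v *\<^sub>R v) = (\<Sum>b\<in>B. cscale (Complex (u b) (u (?J b))) b)" for u
  proof -
    have "(\<Sum>v\<in>?C. u v *\<^sub>R v) = (\<Sum>v\<in>B. u v *\<^sub>R v) + (\<Sum>v\<in>?J ` B. u v *\<^sub>R v)"
      using disj fin by (intro sum.union_disjoint) auto
    also have "(\<Sum>v\<in>?J ` B. u v *\<^sub>R v) = (\<Sum>b\<in>B. u (?J b) *\<^sub>R ?J b)"
      by (subst sum.reindex[OF injJ]) simp
    finally show ?thesis by (simp add: cscale_complex sum.distrib)
  qed
  have "?C \<subseteq> S" using B(1) cmat.subspace_scale[OF S] by auto
  moreover have "S \<subseteq> span ?C"
  proof
    fix x assume "x \<in> S"
    then obtain u where u: "x = (\<Sum>b\<in>B. cscale (u b) b)" using B(3) cmat.span_finite[OF fin] by auto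
    have "cscale (u b) b \<in> span ?C" if "b \<in> B" for b
    proof -
      have "cscale (u b) b = Re (u b) *\<^sub>R b + Im (u b) *\<^sub>R ?J b"
        using cscale_complex[of "Re (u b)" "Im (u b)" b] by simp
      then show ?thesis using that by (simp add: span_add span_scale span_base)
    qed
    then show "x \<in> span ?C" unfolding u by (intro span_sum)
  qed
  moreover have "independent ?C"
    unfolding independent_explicit_finite_subsets
  proof (intro allI impI)
    fix t u assume t: "t \<subseteq> ?C" "finite t" "(\<Sum>v\<in>t. u v *\<^sub>R v) = 0"
    define w where "w v = (if v \<in> t then u v else 0)" for v
    have "(\<Sum>v\<in>?C. w v *\<^sub>R v) = (\<Sum>v\<in>t. u v *\<^sub>R v)"
      using t finC by (intro sum.mono_neutral_cong_right) (auto simp: w_def)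
    then have "(\<Sum>b\<in>B. cscale (Complex (w b) (w (?J b))) b) = 0" using sum_C[of w] t by simp
    then have "Complex (w b) (w (?J b)) = 0" if "b \<in> B" for b
      using indep[OF fin, of "\<lambda>b. Complex (w b) (w (?J b))"] that by simp
    then have "w b = 0 \<and> w (?J b) = 0" if "b \<in> B" for b using that by (auto simp: complex_eq_iff)
    then have "w v = 0" if "v \<in> ?C" for v using that by blast
    then show "\<forall>v\<in>t. u v = 0" using t(1) unfolding w_def by (metis subsetD)
  qed
  ultimately have "card ?C = dim S" by (rule basis_card_eq_dim)
  then show ?thesis using cardC B(4) by simp
qed

lemma trace_inner_cscale_right: "trace_inner A (cscale c B) = cnj c * trace_inner A B"
  by (simp add: trace_inner_def trace_def conj_transpose_def matrix_matrix_mult_def cscale_def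
      sum_distrib_left mult.assoc)

lemma matrix_subspace_imp_subspace: "matrix_subspace F S \<Longrightarrow> subspace S"
  by (cases F) (auto intro: cmat_subspace_imp_subspace)

text \<open>The imaginary part of the trace inner product of \<open>A\<close> with \<open>y\<close> is the real part of that with \<open>\<i> y\<close>, and
  a complex subspace contains \<open>\<i> y\<close> along with \<open>y\<close>.\<close>

lemma orth_proj_field_inner:
  assumes S: "matrix_subspace F S"
  shows "orth_proj (field_inner F) S x = orth_proj (\<bullet>) S x"
proof -
  have "(\<forall>y\<in>S. field_inner F A y = 0) \<longleftrightarrow> (\<forall>y\<in>S. A \<bullet> y = 0)" for A
  proof (cases F)
    case Real_Field
    then show ?thesis by (simp add: Re_trace_inner)
  next
    case Complex_Field
    show ?thesis
    proof
      assume "\<forall>y\<in>S. field_inner F A y = 0"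
      then show "\<forall>y\<in>S. A \<bullet> y = 0" using Complex_Field by (auto simp flip: Re_trace_inner)
    next
      assume 0: "\<forall>y\<in>S. A \<bullet> y = 0"
      show "\<forall>y\<in>S. field_inner F A y = 0"
      proof
        fix y assume y: "y \<in> S"
        then have "cscale \<i> y \<in> S" using S Complex_Field by (simp add: cmat.subspace_scale)
        then have "Re (trace_inner A (cscale \<i> y)) = 0" using 0 by (simp add: Re_trace_inner)
        then have "Im (trace_inner A y) = 0" by (simp add: trace_inner_cscale_right)
        moreover have "Re (trace_inner A y) = 0" using 0 y by (simp add: Re_trace_inner)
        ultimately show "field_inner F A y = 0" using Complex_Field by (simp add: complex_eq_iff)
      qed
    qed
  qed
  then show ?thesis by (simp add: orth_proj_def)
qed

section \<open>The product map and its curvature\<close>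

lemma matrix_add_rdistrib: "((A + B) ** C) = (A ** C) + (B ** C)"
  by (simp add: matrix_matrix_mult_def vec_eq_iff distrib_right sum.distrib)

lemma bounded_bilinear_matrix_mult: "bounded_bilinear ((**) :: complex^'n^'n \<Rightarrow> complex^'n^'n \<Rightarrow> complex^'n^'n)"
  unfolding bilinear_conv_bounded_bilinear[symmetric] bilinear_def
proof (intro conjI allI linearI)
  fix A B C :: "complex^'n^'n" and r :: real
  show "A ** (B + C) = A ** B + A ** C" by (rule matrix_add_ldistrib)
  show "(A + B) ** C = A ** C + B ** C" by (rule matrix_add_rdistrib)
  show "A ** (r *\<^sub>R B) = r *\<^sub>R (A ** B)" "(r *\<^sub>R A) ** B = r *\<^sub>R (A ** B)"
    by (simp_all add: matrix_matrix_mult_def vec_eq_iff scaleR_sum_right)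
qed

lemma smooth_\<Psi>: "smooth_on UNIV \<Psi>"
  unfolding \<Psi>_def case_prod_unfold
  by (rule smooth_on_bilinear[OF open_UNIV bounded_bilinear_matrix_mult
        smooth_on_linear[OF open_UNIV linear_fst] smooth_on_linear[OF open_UNIV linear_snd]])

lemma Df_\<Psi>: "Df \<Psi> (X, Y) = (\<lambda>\<zeta>. X ** snd \<zeta> + fst \<zeta> ** Y)"
proof (rule Df_eq)
  have "((\<lambda>p. fst p ** snd p) has_derivative (\<lambda>\<zeta>. fst (X, Y) ** snd \<zeta> + fst \<zeta> ** snd (X, Y))) (at (X, Y))"
    by (intro bounded_bilinear.FDERIV[OF bounded_bilinear_matrix_mult] has_derivative_fst
        has_derivative_snd has_derivative_ident)
  then show "(\<Psi> has_derivative (\<lambda>\<zeta>. X ** snd \<zeta> + fst \<zeta> ** Y)) (at (X, Y))"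
    by (simp add: \<Psi>_def case_prod_unfold)
qed

lemma derivative_image_eq: "derivative_image \<V>1 \<V>2 X Y = Df \<Psi> (X, Y) ` (\<V>1 \<times> \<V>2)"
  unfolding derivative_image_def Df_\<Psi> by force

lemma matrix_subspace_derivative_image:
  assumes "matrix_subspace F \<V>1" "matrix_subspace F \<V>2"
  shows "matrix_subspace F (derivative_image \<V>1 \<V>2 X Y)"
proof (cases F)
  case Real_Field
  then have "subspace (\<V>1 \<times> \<V>2)" using assms by (simp add: subspace_Times)
  then show ?thesis using Real_Field linear_subspace_image[OF smooth_on_linear_Df[OF smooth_\<Psi>]]
    by (simp add: derivative_image_eq)
next
  case Complex_Field
  have s: "cmat_subspace \<V>1" "cmat_subspace \<V>2" using assms Complex_Field by auto
  have scale: "cscale c (A ** B) = cscale c A ** B" "cscale c (A ** B) = A ** cscale c B" for c and A B :: "complex^'a^'a"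
    by (simp_all add: cscale_def matrix_matrix_mult_def vec_eq_iff sum_distrib_left algebra_simps)
  have "cmat_subspace (derivative_image \<V>1 \<V>2 X Y)"
    unfolding derivative_image_def
  proof (rule cmat.subspaceI)
    show "0 \<in> {X ** W2 + W1 ** Y |W1 W2. W1 \<in> \<V>1 \<and> W2 \<in> \<V>2}"
      using cmat.subspace_0[OF s(1)] cmat.subspace_0[OF s(2)] by force
  next
    fix x y assume "x \<in> {X ** W2 + W1 ** Y |W1 W2. W1 \<in> \<V>1 \<and> W2 \<in> \<V>2}"
      "y \<in> {X ** W2 + W1 ** Y |W1 W2. W1 \<in> \<V>1 \<and> W2 \<in> \<V>2}"
    then obtain W1 W2 W1' W2' where "x = X ** W2 + W1 ** Y" "y = X ** W2' + W1' ** Y"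
      "W1 \<in> \<V>1" "W2 \<in> \<V>2" "W1' \<in> \<V>1" "W2' \<in> \<V>2" by blast
    then have "x + y = X ** (W2 + W2') + (W1 + W1') ** Y" "W1 + W1' \<in> \<V>1" "W2 + W2' \<in> \<V>2"
      using s by (auto simp: matrix_add_ldistrib matrix_add_rdistrib cmat.subspace_add)
    then show "x + y \<in> {X ** W2 + W1 ** Y |W1 W2. W1 \<in> \<V>1 \<and> W2 \<in> \<V>2}" by blast
  next
    fix c x assume "x \<in> {X ** W2 + W1 ** Y |W1 W2. W1 \<in> \<V>1 \<and> W2 \<in> \<V>2}"
    then obtain W1 W2 where "x = X ** W2 + W1 ** Y" "W1 \<in> \<V>1" "W2 \<in> \<V>2" by blast
    then have "cscale c x = X ** cscale c W2 + cscale c W1 ** Y" "cscale c W1 \<in> \<V>1" "cscale c W2 \<in> \<V>2"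
      using s by (simp_all add: cmat.scale_right_distrib scale(2)[of c X] scale(1)[of c _ Y] cmat.subspace_scale)
    then show "cscale c x \<in> {X ** W2 + W1 ** Y |W1 W2. W1 \<in> \<V>1 \<and> W2 \<in> \<V>2}" by blast
  qed
  then show ?thesis using Complex_Field by simp
qed

lemma dim_le_of_matrix_dim_le:
  assumes "matrix_subspace F S" "matrix_subspace F S'" "matrix_dim F S \<le> matrix_dim F S'"
  shows "dim S \<le> dim S'"
  using assms by (cases F) (auto simp: dim_eq_twice_cmat_dim)

text \<open>The comparison curve: a quadratic polynomial in \<open>t\<close> in which \<open>W1 W2\<close> is the coefficient of \<open>t\<^sup>2\<close>.\<close>

lemma product_along_line:
  fixes V1 V2 W1 W2 :: "complex^'n^'n"
  defines "d \<equiv> \<lambda>t. \<Psi> ((V1, V2) + t *\<^sub>R (W1, W2))"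
  shows "smooth_on UNIV d" "velocity d 0 = V1 ** W2 + W1 ** V2" "acceleration d 0 = 2 *\<^sub>R (W1 ** W2)"
proof -
  interpret bounded_bilinear "(**) :: complex^'n^'n \<Rightarrow> complex^'n^'n \<Rightarrow> complex^'n^'n"
    by (rule bounded_bilinear_matrix_mult)
  have "smooth_on UNIV (\<lambda>t::real. (V1, V2) + t *\<^sub>R (W1, W2))"
    by (intro smooth_on_add smooth_on_const smooth_on_linear open_UNIV)
      (auto intro!: linearI simp: scaleR_left_distrib)
  from smooth_on_compose[OF open_UNIV open_UNIV _ this smooth_\<Psi>]
  show "smooth_on UNIV d" unfolding d_def by simp
  have "d t = V1 ** V2 + t *\<^sub>R (V1 ** W2 + W1 ** V2) + t\<^sup>2 *\<^sub>R (W1 ** W2)" for t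
    by (simp add: d_def \<Psi>_def add_left add_right scaleR_left scaleR_right power2_eq_square algebra_simps)
  then have d: "d = (\<lambda>t. V1 ** V2 + t *\<^sub>R (V1 ** W2 + W1 ** V2) + t\<^sup>2 *\<^sub>R (W1 ** W2))" by blast
  have "(d has_vector_derivative V1 ** W2 + W1 ** V2 + (2 * t) *\<^sub>R (W1 ** W2)) (at t)" for t
    unfolding d by (auto intro!: derivative_eq_intros simp: has_vector_derivative_def algebra_simps)
  then have v: "velocity d = (\<lambda>t. V1 ** W2 + W1 ** V2 + (2 * t) *\<^sub>R (W1 ** W2))"
    unfolding velocity_def by (intro ext vector_derivative_at)
  show "velocity d 0 = V1 ** W2 + W1 ** V2" by (simp add: v)
  have "(velocity d has_vector_derivative 2 *\<^sub>R (W1 ** W2)) (at 0)"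
    unfolding v by (auto intro!: derivative_eq_intros simp: has_vector_derivative_def)
  then show "acceleration d 0 = 2 *\<^sub>R (W1 ** W2)"
    unfolding acceleration_def by (rule vector_derivative_at)
qed

theorem proposition3p6:
  fixes F :: ground_field
    and \<V>1 \<V>2 :: "(complex^'n^'n) set"
    and V1 V2 W1 W2 :: "complex^'n^'n"
  assumes "matrix_subspace F \<V>1" and "matrix_subspace F \<V>2"
    and "V1 \<in> \<V>1" and "V2 \<in> \<V>2"
    and "\<forall>X\<in>\<V>1. \<forall>Y\<in>\<V>2. \<Psi>_rank F \<V>1 \<V>2 X Y \<le> \<Psi>_rank F \<V>1 \<V>2 V1 V2"
    and "W1 \<in> \<V>1" and "W2 \<in> \<V>2"
  shows "\<exists>U0. open_nhd_in (\<V>1 \<times> \<V>2) (V1, V2) U0 \<and>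
    (\<forall>U. open_nhd_in (\<V>1 \<times> \<V>2) (V1, V2) U \<and> U \<subseteq> U0 \<longrightarrow>
      smooth_submanifold (\<Psi> ` U) \<and>
      (\<exists>I c. geodesic_from (\<Psi> ` U) (\<Psi> (V1, V2)) (V1 ** W2 + W1 ** V2) I c) \<and>
      (\<forall>I c. geodesic_from (\<Psi> ` U) (\<Psi> (V1, V2)) (V1 ** W2 + W1 ** V2) I c \<longrightarrow>
        extrinsic_curvature c 0 = norm (quadratic_Q F \<V>1 \<V>2 V1 V2 W1 W2)))"
proof -
  let ?Z = "\<V>1 \<times> \<V>2" and ?z = "(V1, V2)" and ?v = "V1 ** W2 + W1 ** V2"
  define T where "T = derivative_image \<V>1 \<V>2 V1 V2"
  have T_eq: "Df \<Psi> ?z ` ?Z = T" by (simp add: T_def derivative_image_eq)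
  have Z: "subspace ?Z" using assms(1,2) matrix_subspace_imp_subspace by (intro subspace_Times)
  have z: "?z \<in> ?Z" using assms(3,4) by simp
  have rank: "dim (Df \<Psi> z ` ?Z) \<le> dim (Df \<Psi> ?z ` ?Z)" if zZ: "z \<in> ?Z" for z
  proof -
    obtain X Y where XY: "z = (X, Y)" "X \<in> \<V>1" "Y \<in> \<V>2" using zZ by auto
    have "matrix_dim F (derivative_image \<V>1 \<V>2 X Y) \<le> matrix_dim F (derivative_image \<V>1 \<V>2 V1 V2)"
      using assms(5) XY unfolding \<Psi>_rank_def by blast
    from dim_le_of_matrix_dim_le[OF matrix_subspace_derivative_image[OF assms(1,2)]
        matrix_subspace_derivative_image[OF assms(1,2)] this]
    show ?thesis by (simp only: derivative_image_eq XY(1))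
  qed
  obtain A B h \<phi> U0 where h: "straightened_submanifold A B T h \<phi>" "0 \<in> B" "h 0 = \<Psi> ?z" "Df h 0 = id"
    and U0: "openin (top_of_set ?Z) U0" "?z \<in> U0"
    and image: "\<And>U. openin (top_of_set ?Z) U \<Longrightarrow> ?z \<in> U \<Longrightarrow> U \<subseteq> U0 \<Longrightarrow>
       \<exists>V. open V \<and> 0 \<in> V \<and> V \<subseteq> B \<and> \<Psi> ` U = h ` (V \<inter> T)"
    by (rule constant_rank_image[OF smooth_\<Psi> Z z rank, unfolded T_eq]) (assumption, rule that)
  have Tsub: "subspace T" using h(1) straightened_submanifold.T by blast
  have vT: "?v \<in> T" unfolding T_def derivative_image_def using assms(6,7) by blast
  show ?thesis
  proof (intro exI[of _ U0] conjI allI impI)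
    show "open_nhd_in ?Z ?z U0" using U0 by (simp add: open_nhd_in_def)
  next
    fix U assume U: "open_nhd_in ?Z ?z U \<and> U \<subseteq> U0"
    then have "\<exists>V. open V \<and> 0 \<in> V \<and> V \<subseteq> B \<and> \<Psi> ` U = h ` (V \<inter> T)"
      unfolding open_nhd_in_def by (intro image) simp_all
    then obtain V where V: "open V" "0 \<in> V" "V \<subseteq> B" "\<Psi> ` U = h ` (V \<inter> T)"
      by (elim exE conjE)
    interpret h: straightened_submanifold "h ` V" V T h \<phi>
      using straightened_submanifold.restrict[OF h(1) V(1,3)] .
    have M: "h.M = \<Psi> ` U" by (simp add: h.M_def V(4))
    have zero: "0 \<in> V \<inter> T" using V(2) Tsub subspace_0 by blast
    have TM: "tangent_space (\<Psi> ` U) (\<Psi> ?z) = T" using h.tangent_space_eq[OF zero] h(3,4) M by simp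
    show "smooth_submanifold (\<Psi> ` U)" using h.smooth_submanifold_M M by simp
    obtain I c where "geodesic_from h.M (h 0) (Df h 0 ?v) I c" using h.geodesic_exists[OF zero vT] by blast
    then show "\<exists>I c. geodesic_from (\<Psi> ` U) (\<Psi> ?z) ?v I c" using M h(3,4) by auto
    fix I c assume c: "geodesic_from (\<Psi> ` U) (\<Psi> ?z) ?v I c"
    define d where "d = (\<lambda>t. \<Psi> (?z + t *\<^sub>R (W1, W2)))"
    note d = product_along_line[of V1 V2 W1 W2, folded d_def]
    obtain U' where U': "open U'" "U = ?Z \<inter> U'" using U unfolding open_nhd_in_def openin_open by blast
    define J where "J = {t::real. ?z + t *\<^sub>R (W1, W2) \<in> U'}"
    have J: "open J" "0 \<in> J" unfolding J_def using open_line_preimage[OF U'(1)] U U'(2)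
      by (auto simp: open_nhd_in_def simp flip: zero_prod_def)
    have d0: "d 0 = \<Psi> ?z" by (simp add: d_def)
    have dU: "d ` J \<subseteq> \<Psi> ` U"
    proof (rule image_subsetI)
      fix t assume "t \<in> J"
      then have "?z + t *\<^sub>R (W1, W2) \<in> U'" by (simp only: J_def mem_Collect_eq)
      moreover have "?z + t *\<^sub>R (W1, W2) \<in> ?Z"
        using Z z assms(6,7) by (intro subspace_add subspace_scale) auto
      ultimately have "?z + t *\<^sub>R (W1, W2) \<in> U" unfolding U'(2) by (intro IntI)
      then show "d t \<in> \<Psi> ` U" unfolding d_def by (rule imageI)
    qed
    have "acceleration c 0 = acceleration d 0 - orth_proj (\<bullet>) T (acceleration d 0)"
      unfolding TM[symmetric]
      using h.geodesic_acceleration[unfolded M, OF c smooth_on_subset[OF d(1) subset_UNIV] J dU d0 d(2)] .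
    also have "\<dots> = quadratic_Q F \<V>1 \<V>2 V1 V2 W1 W2"
      unfolding d(3) quadratic_Q_def proj_P_def T_def[symmetric]
      using orth_proj_field_inner[OF matrix_subspace_derivative_image[OF assms(1,2), of V1 V2], folded T_def]
      by (simp add: orth_proj_scaleR[OF Tsub] scaleR_diff_right)
    finally show "extrinsic_curvature c 0 = norm (quadratic_Q F \<V>1 \<V>2 V1 V2 W1 W2)"
      by (simp add: extrinsic_curvature_def)
  qed
qed

end
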